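(* Let $\beta\in k^\times$, $X^*=\beta\cdot\sqrt\varpi\in\mathfrak t_\varpi^*$ (so $X^*$ is ramified), and let $s,\theta'\in k^\times$, $Y=s\cdot\sqrt{\theta'}\in\mathfrak t_{\theta'}$. If $\operatorname{depth}(X^* )+\operatorname{depth}(Y)>0$, then $$M^G_{X^*}(Y)=c_0(X^* )+q^{-(h+1)}|D_{\mathfrak g}(Y)|^{-1/2}\,\gamma_\Phi(X^*,Y).$$
   Context: $k$ is a non-discrete non-Archimedean local field of residual characteristic $\ne 2$, with ring of integers $\mathcal O$, maximal ideal $\mathfrak p$, valuation $\operatorname{ord}$ with value group $\mathbb Z$, residue field of order $q$, $|x|=q^{-\operatorname{ord}(x)}$; $\varpi$ is a uniformiser. $dx$ (or $dt$) is the Haar measure on $k$ giving $\mathcal O$ measure $1$, and $d^\times x=|x|^{-1}dx$. $\Phi$ is a non-trivial additive character of $k$; $\Phi_b(x)=\Phi(bx)$; the depth of a non-trivial additive character $\Psi$ is $\min\{i\in\mathbb Z:\Psi$ trivial on $\mathfrak p^{i+1}\}$. $k_\varpi=k(\sqrt\varpi)$, $N_\varpi(a+b\sqrt\varpi)=a^2-b^2\varpi$, and $\operatorname{sgn}_\varpi$ is the quadratic character of $k^\times$ with kernel $N_\varpi(k_\varpi^\times)$. $\mathfrak g=\mathfrak{sl}_2(k)$ with dual $\mathfrak g^*$ and pairing $\langle\cdot,\cdot\rangle$. For $\theta\in k^\times$, $\mathfrak t_\theta=k\cdot\sqrt\theta$, where here $\sqrt\theta$ denotes the matrix $\begin{pmatrix}0&1\\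 \theta&0\end{pmatrix}$. $X^*=\beta\sqrt\varpi$ means the functional $Z\mapsto\mathrm{Tr}(\beta\sqrt\varpi Z)$ on $\mathfrak g$. $D_{\mathfrak g}\begin{pmatrix}a&b\\c&-a\end{pmatrix}=4(a^2+bc)$, so $D_{\mathfrak g}(Y)=4s^2\theta'$. Depth: $\operatorname{depth}(c\sqrt\theta)=\tfrac12\operatorname{ord}(c^2\theta)$ for $c\sqrt\theta\in\mathfrak t_\theta$; $\operatorname{depth}(X^* )$ is the largest real $\rho$ such that $\Phi(\langle X^*,Z\rangle)=1$ for all $Z\in\mathfrak t_\varpi$ with $\operatorname{depth}(Z)>-\rho$. Put $r=-\operatorname{depth}(X^* )$, $\Phi'=\Phi_\beta$ and $h=r+\tfrac12=\operatorname{depth}(\Phi')\in\mathbb Z$. Constants: $c_0(X^* )=-\tfrac12q^{-2}(q+1)$. $\gamma_\Phi(X^*,Y)=1$ if $\theta'\in(k^\times)^2$; $=\operatorname{sgn}_\varpi(-s)G_\varpi(\Phi')$ if $\theta'\in\varpi(k^\times)^2$; $=0$ otherwise; here $G_\varpi(\Psi)=q^{-1/2}\sum_{X\in\mathcal O/\mathfrak p}\Psi((-\varpi)^{\operatorname{depth}(\Psi)}X^2)$. Mock Fourier transform: $$M^G_{X^*}(Y)=\sum_{n\in\mathbb Z}\int_{\operatorname{ord}(x)=n}\mathbf 1_{N_\varpi(k_\varpi^\times)}(x)\Bigl(\sum_{l\in\mathbb Z}\int_{\operatorname{ord}(t)=l}\Phi\bigl(\beta s(x\theta'+x^{-1}\varpi-x^{-1}t^2)\bigr)\,dt\Bigr)d^\times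 x,$$ where $\mathbf 1_S$ is the characteristic function of $S$. *)

theory Defs
  imports "HOL-Analysis.Analysis"
begin

section \<open>Non-Archimedean local fields\<close>

text \<open>A field with a discrete valuation of value group \<open>\<int>\<close>. The value \<open>ord 0\<close> (mathematically
  \<open>\<infinity>\<close>) is left unspecified, so that every use below treats \<open>0\<close> separately.\<close>

class discretely_valued_field = field +
  fixes ord :: "'a \<Rightarrow> int"
  assumes ord_mult: "x \<noteq> 0 \<Longrightarrow> y \<noteq> 0 \<Longrightarrow> ord (x * y) = ord x + ord y"
    and ord_add: "x \<noteq> 0 \<Longrightarrow> y \<noteq> 0 \<Longrightarrow> x + y \<noteq> 0 \<Longrightarrow> min (ord x) (ord y) \<le> ord (x + y)"
    and ord_surj: "\<exists>x. x \<noteq> 0 \<and> ord x = n"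

text \<open>The fractional ideal \<open>\<pp>\<^sup>i\<close>; in particular \<open>\<O> = \<pp>\<^sup>0\<close> and \<open>\<pp> = \<pp>\<^sup>1\<close>.\<close>

definition (in discretely_valued_field) pideal :: "int \<Rightarrow> 'a set" where
  "pideal i = {x. x = 0 \<or> i \<le> ord x}"

definition (in discretely_valued_field) residue_field :: "'a set set" where
  "residue_field = pideal 0 // {(x, y). x \<in> pideal 0 \<and> y \<in> pideal 0 \<and> x - y \<in> pideal 1}"

definition (in discretely_valued_field) residue_order :: "'a itself \<Rightarrow> nat" where
  "residue_order _ = card (residue_field :: 'a set set)"

definition (in discretely_valued_field) absv :: "'a \<Rightarrow> real" where
  "absv x = (if x = 0 then 0 else real (residue_order TYPE('a)) powi (- ord x))"

text \<open>The metric is the one of the normalised absolute value, and the field is locally compact for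
  it. It is non-discrete because \<open>ord\<close> is unbounded above, and the residue field is finite because
  \<open>residue_order\<close> would otherwise be \<open>0\<close>, so that \<open>dist\<close> would not be a metric.\<close>

class nonarch_local_field = discretely_valued_field + metric_space +
  assumes dist_absv: "dist x y = absv (x - y)"
    and locally_compact: "\<exists>U K. open U \<and> x \<in> U \<and> U \<subseteq> K \<and> compact K"

definition uniformiser :: "'a::discretely_valued_field \<Rightarrow> bool" where
  "uniformiser \<pi> \<longleftrightarrow> \<pi> \<noteq> 0 \<and> ord \<pi> = 1"

text \<open>The shell \<open>{x \<in> k\<^sup>\<times>. ord x = n}\<close>.\<close>

definition shell :: "int \<Rightarrow> 'a::discretely_valued_field set" where
  "shell n = {x. x \<noteq> 0 \<and> ord x = n}"


section \<open>Haar measure\<close>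

text \<open>Regularity need not be required: it is automatic for a Borel measure that is finite on
  compact sets of a second countable locally compact space.\<close>

definition normalised_haar :: "'a::nonarch_local_field measure \<Rightarrow> bool" where
  "normalised_haar \<mu> \<longleftrightarrow>
     sets \<mu> = sets borel \<and>
     (\<forall>a. \<forall>A\<in>sets borel. emeasure \<mu> ((\<lambda>x. a + x) ` A) = emeasure \<mu> A) \<and>
     (\<forall>K. compact K \<longrightarrow> emeasure \<mu> K < \<infinity>) \<and>
     emeasure \<mu> (pideal 0) = 1"

definition mult_measure :: "'a::nonarch_local_field measure \<Rightarrow> 'a measure" where
  "mult_measure \<mu> = density \<mu> (\<lambda>x. ennreal (inverse (absv x)))"


section \<open>Additive characters\<close>

definition additive_character :: "('a::nonarch_local_field \<Rightarrow> complex) \<Rightarrow> bool" where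
  "additive_character \<Psi> \<longleftrightarrow>
     continuous_on UNIV \<Psi> \<and> (\<forall>x. norm (\<Psi> x) = 1) \<and> (\<forall>x y. \<Psi> (x + y) = \<Psi> x * \<Psi> y)"

definition char_depth :: "('a::discretely_valued_field \<Rightarrow> complex) \<Rightarrow> int" where
  "char_depth \<Psi> = (LEAST i. \<forall>x\<in>pideal (i + 1). \<Psi> x = 1)"

definition char_scale :: "('a::field \<Rightarrow> complex) \<Rightarrow> 'a \<Rightarrow> 'a \<Rightarrow> complex" where
  "char_scale \<Phi> b = (\<lambda>x. \<Phi> (b * x))"


section \<open>The ramified quadratic extension\<close>

text \<open>\<open>N\<^sub>\<pi>(k\<^sub>\<pi>\<^sup>\<times>)\<close>, where \<open>a + b \<surd>\<pi>\<close> has norm \<open>a\<^sup>2 - b\<^sup>2 \<pi>\<close>.\<close>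

definition norm_group :: "'a::field \<Rightarrow> 'a set" where
  "norm_group \<pi> = {a\<^sup>2 - b\<^sup>2 * \<pi> | a b. (a, b) \<noteq> (0, 0)}"

definition sgn_char :: "'a::field \<Rightarrow> 'a \<Rightarrow> complex" where
  "sgn_char \<pi> x = (if x \<in> norm_group \<pi> then 1 else - 1)"

text \<open>The choice of representatives is immaterial, since \<open>\<Psi>\<close> is trivial on \<open>\<pp>\<^bsup>d+1\<^esup>\<close> for
  \<open>d = char_depth \<Psi>\<close>.\<close>

definition gauss_G :: "'a::discretely_valued_field \<Rightarrow> ('a \<Rightarrow> complex) \<Rightarrow> complex" where
  "gauss_G \<pi> \<Psi> =
     of_real (real (residue_order TYPE('a)) powr (- 1 / 2)) *
     (\<Sum>X\<in>residue_field. \<Psi> ((- \<pi>) powi char_depth \<Psi> * (SOME x. x \<in> X)\<^sup>2))"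


section \<open>Tori in sl(2), and depth\<close>

definition sqrt_mat :: "'a::field \<Rightarrow> 'a^2^2" where
  "sqrt_mat \<theta> = vector [vector [0, 1], vector [\<theta>, 0]]"

definition smat :: "'a::field \<Rightarrow> 'a^2^2 \<Rightarrow> 'a^2^2" where
  "smat c A = (\<chi> i j. c * A $ i $ j)"

definition torus :: "'a::field \<Rightarrow> ('a^2^2) set" where
  "torus \<theta> = range (\<lambda>c. smat c (sqrt_mat \<theta>))"

definition disc_g :: "'a::field^2^2 \<Rightarrow> 'a" where
  "disc_g Y = 4 * ((Y $ 1 $ 1)\<^sup>2 + Y $ 1 $ 2 * Y $ 2 $ 1)"

text \<open>For \<open>Z = c \<surd>\<theta>\<close> the coefficient \<open>c\<close> is the upper right entry of \<open>Z\<close>. (The value at \<open>Z = 0\<close>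
  is junk.)\<close>

definition torus_depth :: "'a::discretely_valued_field \<Rightarrow> 'a^2^2 \<Rightarrow> real" where
  "torus_depth \<theta> Z = real_of_int (ord ((Z $ 1 $ 2)\<^sup>2 * \<theta>)) / 2"

definition dual_elt :: "'a::field \<Rightarrow> 'a \<Rightarrow> 'a^2^2 \<Rightarrow> 'a" where
  "dual_elt \<beta> \<theta> = (\<lambda>Z. trace (smat \<beta> (sqrt_mat \<theta>) ** Z))"

text \<open>Depth of a functional \<open>X\<^sup>*\<close> in the dual of \<open>torus \<theta>\<close>. The junk depth of \<open>Z = 0\<close> is harmless
  here, as \<open>\<Phi> 0 = 1\<close>.\<close>

definition dual_depth ::
    "('a::discretely_valued_field \<Rightarrow> complex) \<Rightarrow> 'a \<Rightarrow> ('a^2^2 \<Rightarrow> 'a) \<Rightarrow> real" where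
  "dual_depth \<Phi> \<theta> X =
     (GREATEST \<rho>. \<forall>Z\<in>torus \<theta>. torus_depth \<theta> Z > - \<rho> \<longrightarrow> \<Phi> (X Z) = 1)"


section \<open>The mock Fourier transform and the constants\<close>

text \<open>\<open>c\<^sub>0(X\<^sup>*)\<close> for ramified \<open>X\<^sup>*\<close>; it depends only on the field.\<close>

definition c0_ramified :: "'a::discretely_valued_field itself \<Rightarrow> real" where
  "c0_ramified _ = - (1 / 2) * real (residue_order TYPE('a)) powi (- 2) *
     (real (residue_order TYPE('a)) + 1)"

text \<open>\<open>\<gamma>\<^sub>\<Phi>(X\<^sup>*, Y)\<close> and the mock Fourier transform of \<open>X\<^sup>*\<close> at \<open>Y\<close>, for \<open>X\<^sup>* = \<beta> \<surd>\<pi>\<close> and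
  \<open>Y = s \<surd>\<theta>'\<close>. Both integrals are summed shell by shell, because
  \<open>t \<mapsto> \<Phi> (c t\<^sup>2)\<close> is not integrable over the whole field.\<close>

definition gamma_const ::
    "('a::discretely_valued_field \<Rightarrow> complex) \<Rightarrow> 'a \<Rightarrow> 'a \<Rightarrow> 'a \<Rightarrow> 'a \<Rightarrow> complex" where
  "gamma_const \<Phi> \<pi> \<beta> s \<theta>' =
     (if \<exists>u. u \<noteq> 0 \<and> \<theta>' = u\<^sup>2 then 1
      else if \<exists>u. u \<noteq> 0 \<and> \<theta>' = \<pi> * u\<^sup>2 then sgn_char \<pi> (- s) * gauss_G \<pi> (char_scale \<Phi> \<beta>)
      else 0)"

definition mock_fourier ::
    "'a::nonarch_local_field measure \<Rightarrow> ('a \<Rightarrow> complex) \<Rightarrow> 'a \<Rightarrow> 'a \<Rightarrow> 'a \<Rightarrow> 'a \<Rightarrow> complex" where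
  "mock_fourier \<mu> \<Phi> \<pi> \<beta> s \<theta>' =
     (\<Sum>\<^sub>\<infinity>n\<in>UNIV. LINT x : shell n | mult_measure \<mu>.
        indicator (norm_group \<pi>) x *
        (\<Sum>\<^sub>\<infinity>l\<in>UNIV. LINT t : shell l | \<mu>.
           \<Phi> (\<beta> * s * (x * \<theta>' + inverse x * \<pi> - inverse x * t\<^sup>2))))"

end

theory Submission
  imports Defs
begin

text \<open>Write \<open>\<Psi> = \<Phi>\<^sub>\<beta>\<close>. Small shifts of \<open>t\<close> kill the shells with \<open>ord (a t\<^sup>2) < h\<close>, on the others \<open>\<Psi>(a t\<^sup>2)\<close>
  depends only on \<open>t\<close> modulo \<open>1 + \<pp>\<close>, and \<open>\<integral> \<Psi>(a t\<^sup>2) dt\<close> is \<open>\<bar>a\<bar>\<^bsup>-1/2\<^esup> q\<^bsup>-(h+1)/2\<^esup>\<close>, times a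
  normalised Gauss sum \<open>sgn(a) G\<close> if \<open>ord a \<equiv> h\<close> modulo 2. With \<open>a = - s / x\<close> and \<open>x\<close> a norm the sign
  is constant, and what remains on the shell \<open>ord x = n\<close> is the integral of \<open>\<Psi>(s (x \<theta>' + \<pi> / x))\<close> over
  the norms. By the depth hypothesis \<open>\<Psi>\<close> is trivial on at least one of the two summands, so that
  the integral is the volume of the norms on a finite range of shells, a quadratic Gauss sum on the
  two shells bordering that range, and \<open>0\<close> elsewhere. Since the inner value picks up a factor
  \<open>q\<^bsup>-1\<^esup>\<close> whenever \<open>n\<close> grows by 2, the sum over \<open>n\<close> telescopes: the upper border leaves \<open>c\<^sub>0\<close>, and the
  lower border leaves a term that is evaluated with \<open>G\<^sup>2 = sgn(-1)\<close>.\<close>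

section \<open>Valuations\<close>

text \<open>All integrals are computed without substitution rules or Fubini: a ball c + p^j is cut
  into its q sub-balls, one per residue class, and only translation invariance and the volume of the
  integers enter. So each integral is either a finite sum over residue classes or zero by
  orthogonality. The sets to be integrated over are tame because one-units are squares in odd
  residual characteristic: the norms of order n are exactly \<open>(- \<pi>) powi n\<close> times
  squares of units. On a shell "x is a norm" is thus a condition on one residue class, and it turns
  a sum over units into half of a quadratic Gauss sum. This is also why \<open>- \<pi>\<close>, and
  not \<open>\<pi>\<close>, is the reference element everywhere. The depth hypothesis keeps the two
  border shells apart. If they coincided, both summands of the phase would be non-trivial on the
  same shell and a sum of Kloosterman type over the squares would appear instead of a Gauss
  sum.\<close>

lemma ord_one [simp]: "ord (1 :: 'a::discretely_valued_field) = 0"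
  using ord_mult[of "1 :: 'a" 1] by simp

lemma ord_minus [simp]: "ord (- x) = ord (x :: 'a::discretely_valued_field)"
proof (cases "x = 0")
  case False
  have "ord (- 1 :: 'a) = 0"
    using ord_mult[of "- 1 :: 'a" "- 1"] by simp
  then show ?thesis
    using ord_mult[of "- 1" x] False by simp
qed simp

lemma ord_inverse: "x \<noteq> 0 \<Longrightarrow> ord (inverse x) = - ord x"
  using ord_mult[of x "inverse x"] by simp

lemma ord_divide: "x \<noteq> 0 \<Longrightarrow> y \<noteq> 0 \<Longrightarrow> ord (x / y) = ord x - ord y"
  by (simp add: divide_inverse ord_mult ord_inverse)

lemma ord_power: "x \<noteq> 0 \<Longrightarrow> ord (x ^ n) = int n * ord x"
  by (induction n) (simp_all add: ord_mult algebra_simps)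

lemma ord_power_int: "x \<noteq> 0 \<Longrightarrow> ord (x powi n) = n * ord x"
  by (cases "n \<ge> 0") (simp_all add: power_int_def ord_power ord_inverse)

lemma pideal_zero [simp]: "0 \<in> pideal i"
  by (simp add: pideal_def)

lemma pideal_iff_ord: "x \<noteq> 0 \<Longrightarrow> x \<in> pideal i \<longleftrightarrow> i \<le> ord x"
  by (simp add: pideal_def)

lemma one_in_pideal_iff [simp]: "(1 :: 'a::discretely_valued_field) \<in> pideal i \<longleftrightarrow> i \<le> 0"
  by (simp add: pideal_def)

lemma pideal_minus_iff [simp]: "- x \<in> pideal i \<longleftrightarrow> x \<in> pideal i"
  by (simp add: pideal_def)

lemma pideal_diff_commute: "x - y \<in> pideal i \<longleftrightarrow> y - x \<in> pideal i"
  using pideal_minus_iff[of "x - y" i] by simp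

lemma pideal_add: "x \<in> pideal i \<Longrightarrow> y \<in> pideal i \<Longrightarrow> x + y \<in> pideal i"
  using ord_add[of x y] by (cases "x = 0"; cases "y = 0"; cases "x + y = 0") (auto simp: pideal_def)

lemma pideal_diff: "x \<in> pideal i \<Longrightarrow> y \<in> pideal i \<Longrightarrow> x - y \<in> pideal i"
  using pideal_add[of x i "- y"] by simp

lemma pideal_add_cancel: "y \<in> pideal i \<Longrightarrow> x + y \<in> pideal i \<longleftrightarrow> x \<in> pideal i"
  using pideal_add[of x i y] pideal_diff[of "x + y" i y] by auto

lemma pideal_diff_trans: "x - y \<in> pideal i \<Longrightarrow> y - z \<in> pideal i \<Longrightarrow> x - z \<in> pideal i"
  using pideal_add[of "x - y" i "y - z"] by (simp add: algebra_simps)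

lemma pideal_mono: "x \<in> pideal i \<Longrightarrow> j \<le> i \<Longrightarrow> x \<in> pideal j"
  by (auto simp: pideal_def)

lemma pideal_mult: "x \<in> pideal i \<Longrightarrow> y \<in> pideal j \<Longrightarrow> x * y \<in> pideal (i + j)"
  by (cases "x = 0"; cases "y = 0") (auto simp: pideal_def ord_mult)

lemma pideal_mult_integral: "x \<in> pideal 0 \<Longrightarrow> y \<in> pideal j \<Longrightarrow> x * y \<in> pideal j"
  using pideal_mult[of x 0 y j] by simp

lemma pideal_mult_left_iff: "c \<noteq> 0 \<Longrightarrow> c * x \<in> pideal i \<longleftrightarrow> x \<in> pideal (i - ord c)"
  by (cases "x = 0") (auto simp: pideal_def ord_mult)

lemma pideal_scale: "c \<noteq> 0 \<Longrightarrow> x \<in> pideal i \<Longrightarrow> j \<le> ord c + i \<Longrightarrow> c * x \<in> pideal j"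
  by (simp add: pideal_mult_left_iff) (erule pideal_mono, simp)

lemma ord_add_eq:
  assumes "x \<noteq> 0" "y \<in> pideal (ord x + 1)"
  shows "x + y \<noteq> 0" "ord (x + y) = ord x"
proof -
  show nz: "x + y \<noteq> 0"
  proof
    assume "x + y = 0"
    then have "y = - x" by (simp add: eq_neg_iff_add_eq_0 add.commute)
    with assms show False by (simp add: pideal_iff_ord)
  qed
  show "ord (x + y) = ord x"
  proof (cases "y = 0")
    case False
    have "ord (x + y) \<ge> ord x"
      using ord_add[OF assms(1) False nz] assms False by (simp add: pideal_iff_ord)
    moreover have "ord x \<ge> min (ord (x + y)) (ord y)"
      using ord_add[of "x + y" "- y"] nz False assms by simp
    ultimately show ?thesis using assms False by (simp add: pideal_iff_ord)
  qed simp
qed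

lemma ord_eq_of_diff:
  assumes "x \<noteq> 0" "y - x \<in> pideal (ord x + 1)"
  shows "y \<noteq> 0" "ord y = ord x"
  using ord_add_eq[OF assms] by (simp_all add: algebra_simps)

lemma ord_zero_iff: "x \<noteq> 0 \<and> ord x = 0 \<longleftrightarrow> x \<in> pideal 0 \<and> x \<notin> pideal 1"
  by (auto simp: pideal_def)


section \<open>The residue field\<close>

text \<open>The same \<open>SOME\<close> choice as in \<open>gauss_G\<close>, so that the sum over
  classes there becomes a sum over field elements by plain reindexing.\<close>

definition residue_reps :: "'a::discretely_valued_field set" where
  "residue_reps = (\<lambda>X. SOME x. x \<in> X) ` residue_field"

definition residue_rep :: "'a::discretely_valued_field \<Rightarrow> 'a" where
  "residue_rep x = (THE r. r \<in> residue_reps \<and> x - r \<in> pideal 1)"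

definition residue_units :: "'a::discretely_valued_field set" where
  "residue_units = {r \<in> residue_reps. r \<notin> pideal 1}"

definition residue_class_function :: "('a::discretely_valued_field \<Rightarrow> 'b) \<Rightarrow> bool" where
  "residue_class_function F \<longleftrightarrow> (\<forall>x\<in>pideal 0. \<forall>y\<in>pideal 0. x - y \<in> pideal 1 \<longrightarrow> F x = F y)"

lemma residue_class_functionD:
  "residue_class_function F \<Longrightarrow> x \<in> pideal 0 \<Longrightarrow> y \<in> pideal 0 \<Longrightarrow> x - y \<in> pideal 1 \<Longrightarrow> F x = F y"
  unfolding residue_class_function_def by blast

abbreviation residue_rel :: "('a::discretely_valued_field \<times> 'a) set" where
  "residue_rel \<equiv> {(x, y). x \<in> pideal 0 \<and> y \<in> pideal 0 \<and> x - y \<in> pideal 1}"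

lemma equiv_residue_rel: "equiv (pideal 0) (residue_rel :: ('a::discretely_valued_field \<times> 'a) set)"
proof (rule equivI)
  show "sym (residue_rel :: ('a \<times> 'a) set)"
  proof (rule symI)
    fix x y :: 'a
    assume "(x, y) \<in> residue_rel"
    then show "(y, x) \<in> residue_rel"
      using pideal_diff_commute[of x y 1] by simp
  qed
  show "trans (residue_rel :: ('a \<times> 'a) set)"
  proof (rule transI)
    fix x y z :: 'a
    assume "(x, y) \<in> residue_rel" "(y, z) \<in> residue_rel"
    then show "(x, z) \<in> residue_rel"
      using pideal_diff_trans[of x y 1 z] by simp
  qed
qed (auto simp: refl_on_def)

lemma residue_field_some_in:
  assumes "X \<in> (residue_field :: 'a::discretely_valued_field set set)"
  shows "(SOME x. x \<in> X) \<in> X"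
proof -
  have "X \<noteq> {}"
    using in_quotient_imp_non_empty[OF equiv_residue_rel] assms unfolding residue_field_def .
  then show ?thesis by (simp add: some_in_eq)
qed

lemma inj_residue_field_some:
  "inj_on (\<lambda>X. SOME x. x \<in> X) (residue_field :: 'a::discretely_valued_field set set)"
proof (rule inj_onI)
  fix X Y :: "'a set"
  assume XY: "X \<in> residue_field" "Y \<in> residue_field" "(SOME x. x \<in> X) = (SOME x. x \<in> Y)"
  have "(SOME x. x \<in> X) \<in> X \<inter> Y"
    using residue_field_some_in[OF XY(1)] residue_field_some_in[OF XY(2)] XY(3) by simp
  then have "X \<inter> Y \<noteq> {}" by (metis empty_iff)
  with XY(1,2) show "X = Y"
    using quotient_disj[OF equiv_residue_rel, of X Y] unfolding residue_field_def by simp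
qed

lemma card_residue_reps:
  "card (residue_reps :: 'a::discretely_valued_field set) = residue_order TYPE('a)"
  unfolding residue_reps_def residue_order_def by (rule card_image[OF inj_residue_field_some])

lemma residue_reps_integral: "r \<in> residue_reps \<Longrightarrow> r \<in> pideal 0"
proof -
  assume "r \<in> residue_reps"
  then obtain X where "X \<in> residue_field" "r \<in> X"
    unfolding residue_reps_def using residue_field_some_in by blast
  then show ?thesis
    using in_quotient_imp_subset[OF equiv_residue_rel] unfolding residue_field_def by blast
qed

lemma residue_reps_unique:
  fixes r :: "'a::discretely_valued_field"
  assumes "r \<in> residue_reps" "r' \<in> residue_reps" "r - r' \<in> pideal 1"
  shows "r = r'"
proof -
  obtain X Y where XY: "X \<in> residue_field" "Y \<in> residue_field"
      "r = (SOME x. x \<in> X)" "r' = (SOME x. x \<in> Y)"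
    using assms unfolding residue_reps_def by blast
  have "r \<in> X" "r' \<in> Y" using XY residue_field_some_in by auto
  moreover have "(r, r') \<in> residue_rel" using assms residue_reps_integral by auto
  ultimately have "X = Y"
    using XY quotient_eqI[OF equiv_residue_rel] unfolding residue_field_def by blast
  then show ?thesis using XY by simp
qed

lemma residue_reps_exists:
  fixes x :: "'a::discretely_valued_field"
  assumes "x \<in> pideal 0"
  shows "\<exists>r\<in>residue_reps. x - r \<in> pideal 1"
proof -
  let ?X = "residue_rel `` {x}"
  have X: "?X \<in> residue_field"
    unfolding residue_field_def using assms by (rule quotientI)
  have "(SOME y. y \<in> ?X) \<in> ?X"
    using residue_field_some_in[OF X] .
  then show ?thesis
    using X unfolding residue_reps_def by blast
qed

lemma residue_rep:
  assumes "x \<in> pideal 0"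
  shows residue_rep_in: "residue_rep x \<in> residue_reps"
    and residue_rep_diff: "x - residue_rep x \<in> pideal 1"
proof -
  have "\<exists>!r. r \<in> residue_reps \<and> x - r \<in> pideal 1"
  proof (rule ex_ex1I)
    show "\<exists>r. r \<in> residue_reps \<and> x - r \<in> pideal 1"
      using residue_reps_exists[OF assms] by blast
  next
    fix r r'
    assume r: "r \<in> residue_reps \<and> x - r \<in> pideal 1" "r' \<in> residue_reps \<and> x - r' \<in> pideal 1"
    then have "r - r' \<in> pideal 1" using pideal_diff[of "x - r'" 1 "x - r"] by simp
    with r show "r = r'" using residue_reps_unique by blast
  qed
  from theI'[OF this] show "residue_rep x \<in> residue_reps" "x - residue_rep x \<in> pideal 1"
    unfolding residue_rep_def by auto
qed

lemma residue_rep_integral: "x \<in> pideal 0 \<Longrightarrow> residue_rep x \<in> pideal 0"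
  using residue_rep_in residue_reps_integral by blast

lemma residue_rep_eqI:
  assumes "x \<in> pideal 0" "r \<in> residue_reps" "x - r \<in> pideal 1"
  shows "residue_rep x = r"
proof (rule residue_reps_unique)
  show "residue_rep x - r \<in> pideal 1"
    using pideal_diff[OF assms(3) residue_rep_diff[OF assms(1)]] by simp
qed (use assms residue_rep_in in auto)

lemma residue_rep_eq_iff:
  assumes "x \<in> pideal 0" "y \<in> pideal 0"
  shows "residue_rep x = residue_rep y \<longleftrightarrow> x - y \<in> pideal 1"
proof
  assume "residue_rep x = residue_rep y"
  then show "x - y \<in> pideal 1"
    using pideal_diff[OF residue_rep_diff[OF assms(1)] residue_rep_diff[OF assms(2)]] by simp
next
  assume "x - y \<in> pideal 1"
  then have "x - residue_rep y \<in> pideal 1"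
    using pideal_diff_trans residue_rep_diff[OF assms(2)] by blast
  then show "residue_rep x = residue_rep y"
    using assms residue_rep_eqI residue_rep_in by blast
qed

lemma residue_class_function_rep:
  assumes "residue_class_function F" "x \<in> pideal 0"
  shows "F (residue_rep x) = F x"
  by (rule residue_class_functionD[OF assms(1,2) residue_rep_integral residue_rep_diff, symmetric])
    (fact assms(2))+

lemma residue_rep_units:
  assumes "x \<in> pideal 0"
  shows "residue_rep x \<in> residue_units \<longleftrightarrow> x \<notin> pideal 1"
  using pideal_add_cancel[OF residue_rep_diff[OF assms], of "residue_rep x"] residue_rep_in[OF assms]
  by (simp add: residue_units_def)

lemma residue_unitsD:
  assumes "r \<in> residue_units"
  shows "r \<in> residue_reps" "r \<noteq> 0" "ord r = 0" "r \<in> pideal 0"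
  using assms residue_reps_integral[of r] ord_zero_iff[of r] by (auto simp: residue_units_def)

text \<open>Injectivity modulo p and equal finite cardinality force surjectivity, so no inverse
  substitution has to be exhibited. Since \<phi> may leave the set of representatives,
  \<open>residue_rep\<close> brings its values back.\<close>

lemma residue_rep_bij:
  fixes \<phi> :: "'b \<Rightarrow> 'a::discretely_valued_field"
  assumes "finite B" "card A = card B"
    and int: "\<And>r. r \<in> A \<Longrightarrow> \<phi> r \<in> pideal 0"
    and inj: "\<And>r r'. r \<in> A \<Longrightarrow> r' \<in> A \<Longrightarrow> \<phi> r - \<phi> r' \<in> pideal 1 \<Longrightarrow> r = r'"
    and B: "\<And>r. r \<in> A \<Longrightarrow> residue_rep (\<phi> r) \<in> B"
  shows "bij_betw (\<lambda>r. residue_rep (\<phi> r)) A B"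
proof -
  have inj: "inj_on (\<lambda>r. residue_rep (\<phi> r)) A"
  proof (rule inj_onI)
    fix r r' assume "r \<in> A" "r' \<in> A" "residue_rep (\<phi> r) = residue_rep (\<phi> r')"
    then show "r = r'"
      using residue_rep_eq_iff[OF int int, of r r'] inj[of r r'] by blast
  qed
  have "(\<lambda>r. residue_rep (\<phi> r)) ` A = B"
    using assms(1,2) B card_image[OF inj] by (intro card_subset_eq) auto
  with inj show ?thesis
    by (simp add: bij_betw_def)
qed

lemma sum_residue_bij:
  fixes F :: "'a::discretely_valued_field \<Rightarrow> 'b::comm_monoid_add"
  assumes F: "residue_class_function F" and "finite B" "card A = card B"
    and int: "\<And>r. r \<in> A \<Longrightarrow> \<phi> r \<in> pideal 0"
    and "\<And>r r'. r \<in> A \<Longrightarrow> r' \<in> A \<Longrightarrow> \<phi> r - \<phi> r' \<in> pideal 1 \<Longrightarrow> r = r'"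
    and "\<And>r. r \<in> A \<Longrightarrow> residue_rep (\<phi> r) \<in> B"
  shows "(\<Sum>r\<in>A. F (\<phi> r)) = (\<Sum>r\<in>B. F r)"
proof -
  have "(\<Sum>r\<in>A. F (\<phi> r)) = (\<Sum>r\<in>A. F (residue_rep (\<phi> r)))"
    using residue_class_function_rep[OF F int] by (intro sum.cong) auto
  also have "\<dots> = (\<Sum>r\<in>B. F r)"
  proof (rule sum.reindex_bij_betw)
    show "bij_betw (\<lambda>r. residue_rep (\<phi> r)) A B"
      by (rule residue_rep_bij) (fact assms)+
  qed
  finally show ?thesis .
qed

lemma pideal_prime:
  "x \<in> pideal 0 \<Longrightarrow> y \<in> pideal 0 \<Longrightarrow> x * y \<in> pideal 1 \<Longrightarrow> x \<in> pideal 1 \<or> y \<in> pideal 1"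
  by (cases "x = 0"; cases "y = 0") (auto simp: pideal_def ord_mult)

section \<open>Topology\<close>

lemma residue_order_gt_1: "residue_order TYPE('k::nonarch_local_field) > 1"
proof -
  have "residue_order TYPE('k) \<noteq> 0"
  proof
    \<comment> \<open>An infinite residue field would have \<open>card\<close> 0, and
      \<open>0 powi (- 1) = 0\<close> would put a nonzero element at distance 0 from 0.\<close>
    assume 0: "residue_order TYPE('k) = 0"
    obtain x :: 'k where x: "x \<noteq> 0" "ord x = 1" using ord_surj by blast
    then have "dist x 0 = 0" using 0 by (simp add: dist_absv absv_def)
    with x show False by simp
  qed
  then have fin: "finite (residue_reps :: 'k set)"
    by (metis card.infinite card_residue_reps)
  have ne: "residue_rep 0 \<noteq> residue_rep (1 :: 'k)"
    using residue_rep_eq_iff[of "0 :: 'k" 1] by simp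
  have "{residue_rep 0, residue_rep (1 :: 'k)} \<subseteq> residue_reps"
    using residue_rep_in[of "0 :: 'k"] residue_rep_in[of "1 :: 'k"] by simp
  from card_mono[OF fin this] ne show ?thesis by (simp add: card_residue_reps)
qed

lemma finite_residue_reps [simp]: "finite (residue_reps :: 'k::nonarch_local_field set)"
  using residue_order_gt_1[where 'k = 'k] card_residue_reps[where 'a = 'k]
  by (metis card.infinite less_nat_zero_code)

lemma finite_residue_units [simp]: "finite (residue_units :: 'k::nonarch_local_field set)"
  by (simp add: residue_units_def)

lemma residue_order_real_gt_1: "real (residue_order TYPE('k::nonarch_local_field)) > 1"
  using residue_order_gt_1[where 'k = 'k] by simp

lemma residue_reps_split:
  "residue_reps = insert (residue_rep 0) (residue_units :: 'k::nonarch_local_field set)"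
  (is "?A = ?B") and residue_rep_0_notin: "residue_rep (0 :: 'k) \<notin> residue_units"
proof -
  have *: "r = residue_rep 0" if "r \<in> residue_reps" "r \<in> pideal 1" for r :: 'k
    using residue_rep_eqI[of 0 r] that by simp
  show "?A = ?B"
    using residue_rep_in[of "0 :: 'k"] * by (auto simp: residue_units_def)
  show "residue_rep (0 :: 'k) \<notin> residue_units"
    using residue_rep_units[of "0 :: 'k"] by simp
qed

lemma sum_residue_reps:
  fixes F :: "'k::nonarch_local_field \<Rightarrow> 'b::comm_monoid_add"
  assumes "residue_class_function F"
  shows "(\<Sum>r\<in>residue_reps. F r) = F 0 + (\<Sum>r\<in>residue_units. F r)"
  unfolding residue_reps_split
  by (simp add: residue_rep_0_notin residue_class_function_rep[OF assms])

lemma card_residue_units: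
  "card (residue_units :: 'k::nonarch_local_field set) = residue_order TYPE('k) - 1"
proof -
  have "card (insert (residue_rep 0) (residue_units :: 'k set)) = Suc (card (residue_units :: 'k set))"
    by (simp add: residue_rep_0_notin)
  then show ?thesis
    using card_residue_reps[where 'a = 'k] by (simp flip: residue_reps_split)
qed

lemma absv_mult: "absv (x * y) = absv x * absv (y :: 'k::nonarch_local_field)"
  using residue_order_real_gt_1[where 'k = 'k]
  by (cases "x = 0"; cases "y = 0") (auto simp: absv_def ord_mult simp flip: power_int_add)

lemma power_int_le_iff: "1 < (a :: real) \<Longrightarrow> a powi m \<le> a powi n \<longleftrightarrow> m \<le> n"
  using power_int_strict_increasing[of n m a] power_int_increasing[of m n a] by fastforce

lemma absv_le_iff:
  "absv x \<le> real (residue_order TYPE('k)) powi (- j) \<longleftrightarrow> x \<in> pideal (j :: int)"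
  for x :: "'k::nonarch_local_field"
proof (cases "x = 0")
  case False
  have "real (residue_order TYPE('k)) powi (- ord x) \<le> real (residue_order TYPE('k)) powi (- j) \<longleftrightarrow>
      - ord x \<le> - j"
    using residue_order_real_gt_1[where 'k = 'k] by (rule power_int_le_iff)
  with False show ?thesis by (simp add: absv_def pideal_iff_ord)
qed (simp add: absv_def)

lemma dist_le_iff:
  "dist x y \<le> real (residue_order TYPE('k)) powi (- j) \<longleftrightarrow> x - y \<in> pideal (j :: int)"
  for x y :: "'k::nonarch_local_field"
  by (simp add: dist_absv absv_le_iff)

section \<open>Balls c + p^j and compactness of the ring of integers\<close>

definition coset :: "'a::discretely_valued_field \<Rightarrow> int \<Rightarrow> 'a set" where
  "coset c j = {x. x - c \<in> pideal j}"

lemma coset_zero: "coset 0 j = pideal j"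
  by (simp add: coset_def)

lemma open_coset_invariant:
  fixes S :: "'k::nonarch_local_field set"
  assumes "\<And>x. x \<in> S \<Longrightarrow> \<exists>j. coset x j \<subseteq> S"
  shows "open S"
  unfolding open_dist
proof
  fix x assume "x \<in> S"
  then obtain j where j: "coset x j \<subseteq> S" using assms by blast
  let ?e = "real (residue_order TYPE('k)) powi (- j)"
  have "y \<in> S" if "dist y x < ?e" for y
    using that j dist_le_iff[of y x j] by (auto simp: coset_def)
  moreover have "?e > 0" using residue_order_real_gt_1[where 'k = 'k] by simp
  ultimately show "\<exists>e>0. \<forall>y. dist y x < e \<longrightarrow> y \<in> S" by blast
qed

lemma open_coset [simp]: "open (coset (c :: 'k::nonarch_local_field) j)"
proof (rule open_coset_invariant)
  fix x assume "x \<in> coset c j"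
  then have "coset x j \<subseteq> coset c j"
    using pideal_diff_trans[of _ x j c] by (auto simp: coset_def)
  then show "\<exists>j'. coset x j' \<subseteq> coset c j" by blast
qed

lemma closed_coset [simp]: "closed (coset (c :: 'k::nonarch_local_field) j)"
  unfolding closed_def
proof (rule open_coset_invariant)
  fix x assume x: "x \<in> - coset c j"
  have "y \<notin> coset c j" if "y \<in> coset x j" for y
  proof
    assume "y \<in> coset c j"
    then have "x - c \<in> pideal j"
      using that pideal_diff[of "y - c" j "y - x"] by (simp add: coset_def)
    then show False using x by (simp add: coset_def)
  qed
  then show "\<exists>j'. coset x j' \<subseteq> - coset c j" by blast
qed

lemma dist_mult_left: "dist (c * x) (c * y) = absv c * dist x (y :: 'k::nonarch_local_field)"
  by (simp add: dist_absv absv_mult flip: right_diff_distrib)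

lemma continuous_mult_left: "continuous_on S (\<lambda>x. c * x :: 'k::nonarch_local_field)"
proof -
  have "0 \<le> absv c" using zero_le_dist[of c 0] by (simp add: dist_absv)
  then have "(absv c)-lipschitz_on S (\<lambda>x. c * x)"
    by (intro lipschitz_onI) (simp_all add: dist_mult_left)
  then show ?thesis by (rule lipschitz_on_continuous_on)
qed

text \<open>Local compactness only yields some compact neighbourhood of 0. It contains a closed ball
  p^n, and multiplication by an element of order -n carries p^n continuously onto the
  integers.\<close>

lemma compact_pideal_zero: "compact (pideal 0 :: 'k::nonarch_local_field set)"
proof -
  let ?q = "real (residue_order TYPE('k))"
  have q: "?q > 1" by (rule residue_order_real_gt_1)
  obtain U K :: "'k set" where UK: "open U" "0 \<in> U" "U \<subseteq> K" "compact K"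
    using locally_compact by blast
  then obtain e where e: "e > 0" "\<And>y. dist y 0 < e \<Longrightarrow> y \<in> U"
    unfolding open_dist by blast
  obtain n where n: "inverse e < ?q ^ n" using real_arch_pow[OF q] by blast
  then have "?q powi (- int n) < e"
    using e q by (simp add: power_int_minus field_simps)
  then have "pideal (int n) \<subseteq> U"
    using e dist_le_iff[of _ "0 :: 'k" "int n"] by (metis diff_zero order_le_less_trans subsetI)
  then have cpt: "compact (pideal (int n) :: 'k set)"
    using compact_Int_closed[OF UK(4), of "pideal (int n)"] UK(3) closed_coset[of "0 :: 'k" "int n"]
    by (simp add: coset_zero Int_absorb1 order_trans)
  obtain x :: 'k where x: "x \<noteq> 0" "ord x = - int n" using ord_surj by blast
  have "(\<lambda>y. x * y) ` pideal (int n) = pideal 0"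
  proof (intro set_eqI iffI)
    fix y assume "y \<in> (\<lambda>y. x * y) ` pideal (int n)"
    then show "y \<in> pideal 0" using x pideal_mult_left_iff[of x _ 0] by auto
  next
    fix y :: 'k assume "y \<in> pideal 0"
    then have "x * (y / x) \<in> pideal 0" using x by simp
    then have "y / x \<in> pideal (int n)" using x pideal_mult_left_iff[of x "y / x" 0] by simp
    moreover have "y = x * (y / x)" using x by simp
    ultimately show "y \<in> (\<lambda>y. x * y) ` pideal (int n)" by (rule rev_image_eqI)
  qed
  then show ?thesis
    using compact_continuous_image[OF continuous_mult_left cpt, of x] by simp
qed


section \<open>Squares and the norm group\<close>

lemma ord_two:
  assumes "(2 :: 'k::nonarch_local_field) \<notin> pideal 1"
  shows "(2 :: 'k) \<noteq> 0" "ord (2 :: 'k) = 0"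
proof -
  have "(1 + 1 :: 'k) \<in> pideal 0" by (rule pideal_add) simp_all
  then have "(2 :: 'k) \<noteq> 0 \<and> ord (2 :: 'k) = 0"
    using assms ord_zero_iff[of "2 :: 'k"] by simp
  then show "(2 :: 'k) \<noteq> 0" "ord (2 :: 'k) = 0" by auto
qed

text \<open>The root minimises \<open>\<bar>y\<^sup>2 - a\<bar>\<close> over the compact set \<open>1 + \<pp>\<close>: a Newton step from a point
  with \<open>y\<^sup>2 \<noteq> a\<close> strictly decreases this distance.\<close>

lemma one_unit_is_square:
  fixes a :: "'k::nonarch_local_field"
  assumes two: "(2 :: 'k) \<notin> pideal 1" and a: "a - 1 \<in> pideal 1"
  shows "\<exists>y. y\<^sup>2 = a"
proof -
  let ?S = "coset 1 1 :: 'k set"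
  have S_int: "y \<in> pideal 0" if "y \<in> ?S" for y
    using that pideal_add[of "y - 1" 0 1] pideal_mono[of "y - 1" 1 0] by (simp add: coset_def)
  have "compact (pideal 0 \<inter> ?S)"
    by (intro compact_Int_closed compact_pideal_zero closed_coset)
  moreover have "pideal 0 \<inter> ?S = ?S" using S_int by blast
  ultimately have cpt: "compact ?S" by simp
  have "1-lipschitz_on ?S (\<lambda>y. y\<^sup>2)"
  proof (rule lipschitz_onI)
    fix y z assume "y \<in> ?S" "z \<in> ?S"
    then have "y + z \<in> pideal 0" using S_int pideal_add by blast
    then have "absv (y + z) \<le> 1" using absv_le_iff[of "y + z" 0] by simp
    moreover have "dist (y\<^sup>2) (z\<^sup>2) = absv (y + z) * dist y z"
      by (simp add: dist_absv power2_eq_square square_diff_square_factored flip: absv_mult)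
    ultimately show "dist (y\<^sup>2) (z\<^sup>2) \<le> 1 * dist y z"
      using mult_right_mono[of "absv (y + z)" 1 "dist y z"] by simp
  qed simp
  then have "continuous_on ?S (\<lambda>y. dist (y\<^sup>2) a)"
    by (intro continuous_on_dist lipschitz_on_continuous_on continuous_on_const)
  moreover have "?S \<noteq> {}" by (auto simp: coset_def intro!: exI[of _ 1])
  ultimately obtain y where y: "y \<in> ?S" and min: "\<And>z. z \<in> ?S \<Longrightarrow> dist (y\<^sup>2) a \<le> dist (z\<^sup>2) a"
    using continuous_attains_inf[OF cpt] by blast
  have "y\<^sup>2 = a"
  proof (rule ccontr)
    assume ne: "y\<^sup>2 \<noteq> a"
    have y_unit: "y \<noteq> 0" "ord y = 0" using y ord_eq_of_diff[of 1 y] by (simp_all add: coset_def)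
    have "y\<^sup>2 - 1 \<in> pideal 1"
    proof -
      have "(y + 1) * (y - 1) \<in> pideal 1"
        using y S_int[OF y] by (intro pideal_mult_integral pideal_add) (simp_all add: coset_def)
      then show ?thesis by (simp add: power2_eq_square algebra_simps)
    qed
    then have d: "y\<^sup>2 - a \<in> pideal 1" using pideal_diff[OF _ a, of "y\<^sup>2 - 1"] by simp
    \<comment> \<open>As \<open>2 * y\<close> is a unit, e has the order of the error of y, whereas
      the error of \<open>y - e\<close> is exactly the square of e, of twice that order.\<close>
    define e where "e = (y\<^sup>2 - a) / (2 * y)"
    have e: "e \<noteq> 0" "ord e = ord (y\<^sup>2 - a)"
      using ne y_unit ord_two[OF two] by (simp_all add: e_def ord_divide ord_mult)
    then have e1: "ord e \<ge> 1" using d ne by (simp add: pideal_iff_ord)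
    have "y - e \<in> ?S"
      using pideal_diff[of "y - 1" 1 e] y e e1 by (simp add: coset_def pideal_iff_ord algebra_simps)
    from min[OF this] have "dist (y\<^sup>2) a \<le> dist ((y - e)\<^sup>2) a" .
    moreover have "(y - e)\<^sup>2 - a = e\<^sup>2"
    proof -
      have "2 * y * e = y\<^sup>2 - a" using y_unit ord_two[OF two] by (simp add: e_def)
      then show ?thesis by (simp add: power2_eq_square algebra_simps)
    qed
    ultimately have "absv (y\<^sup>2 - a) \<le> absv (e\<^sup>2)" by (simp add: dist_absv)
    then have "real (residue_order TYPE('k)) powi (- ord e) \<le>
        real (residue_order TYPE('k)) powi (- ord (e\<^sup>2))"
      using e ne by (simp add: absv_def)
    then have "- ord e \<le> - ord (e\<^sup>2)"
      by (simp only: power_int_le_iff[OF residue_order_real_gt_1])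
    with e1 e show False by (simp add: ord_power)
  qed
  then show ?thesis by blast
qed

locale ramified_setting =
  fixes \<pi> :: "'k::nonarch_local_field"
  assumes two: "(2 :: 'k) \<notin> pideal 1" and unif: "uniformiser \<pi>"
begin

lemma pi_nonzero [simp]: "\<pi> \<noteq> 0" and ord_pi [simp]: "ord \<pi> = 1"
  using unif by (auto simp: uniformiser_def)

lemma ord_pi_power_int [simp]: "ord ((- \<pi>) powi n) = n"
  by (simp add: ord_power_int)

lemma pi_power_int_square: "((- \<pi>) powi n)\<^sup>2 = (- \<pi>) powi (2 * n)"
  by (simp add: power_int_power' mult.commute)

text \<open>The terms \<open>a\<^sup>2\<close> and \<open>b\<^sup>2 * \<pi>\<close> have orders of
  different parity, so one dominates. Pulling it out leaves a factor in 1 + p, which is a square;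
  hence a norm is a square or \<open>- \<pi>\<close> times a square, according to the parity of its
  order.\<close>

lemma norm_group_iff: "x \<in> norm_group \<pi> \<longleftrightarrow> x \<noteq> 0 \<and> (\<exists>y. x = (- \<pi>) powi (ord x) * y\<^sup>2)"
proof
  assume "x \<in> norm_group \<pi>"
  then obtain a b where x: "x = a\<^sup>2 - b\<^sup>2 * \<pi>" and ab: "a \<noteq> 0 \<or> b \<noteq> 0"
    unfolding norm_group_def by blast
  have even_case: "z\<^sup>2 = (- \<pi>) powi (2 * ord z) * (z / (- \<pi>) powi ord z)\<^sup>2"
    if "z \<noteq> 0" for z
    using that by (simp add: power_divide pi_power_int_square)
  show "x \<noteq> 0 \<and> (\<exists>y. x = (- \<pi>) powi (ord x) * y\<^sup>2)"
  proof (cases "a \<noteq> 0 \<and> (b = 0 \<or> ord a \<le> ord b)")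
    case True
    define w where "w = - (b / a)\<^sup>2 * \<pi>"
    have "w \<in> pideal 1"
    proof (cases "b = 0")
      case False
      with True show ?thesis by (simp add: w_def pideal_iff_ord ord_mult ord_power ord_divide)
    qed (simp add: w_def)
    then obtain z where z: "z\<^sup>2 = 1 + w" using one_unit_is_square[OF two, of "1 + w"] by auto
    have "1 + w \<noteq> 0" using ord_eq_of_diff(1)[of 1 "1 + w"] \<open>w \<in> pideal 1\<close> by simp
    then have "a * z \<noteq> 0" using z True by auto
    moreover have "x = (a * z)\<^sup>2"
      using True by (simp add: x power_mult_distrib z w_def power_divide field_simps)
    ultimately show ?thesis
      using even_case[of "a * z"] ord_power[of "a * z" 2]
      by (metis of_nat_numeral power_not_zero)
  next
    case False
    then have b: "b \<noteq> 0" and ab': "a = 0 \<or> ord b < ord a" using ab by auto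
    define w where "w = - (a / b)\<^sup>2 / \<pi>"
    have "w \<in> pideal 1"
    proof (cases "a = 0")
      case False
      with b ab' show ?thesis by (simp add: w_def pideal_iff_ord ord_mult ord_power ord_divide)
    qed (simp add: w_def)
    then obtain z where z: "z\<^sup>2 = 1 + w" using one_unit_is_square[OF two, of "1 + w"] by auto
    have "1 + w \<noteq> 0" using ord_eq_of_diff(1)[of 1 "1 + w"] \<open>w \<in> pideal 1\<close> by simp
    then have bz: "b * z \<noteq> 0" using z b by auto
    have x': "x = - \<pi> * (b * z)\<^sup>2"
      using b by (simp add: x power_mult_distrib z w_def power_divide field_simps)
    have "ord x = ord (- \<pi>) + ord ((b * z)\<^sup>2)"
      unfolding x' using bz by (intro ord_mult) auto
    then have ord_x: "ord x = 1 + 2 * ord (b * z)" using ord_power[OF bz, of 2] by simp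
    have "x = (- \<pi>) powi (1 + 2 * ord (b * z)) * (b * z / (- \<pi>) powi ord (b * z))\<^sup>2"
      unfolding x' by (subst even_case[OF bz]) (simp add: power_int_add mult.assoc)
    moreover have "x \<noteq> 0" using bz x' by simp
    ultimately show ?thesis unfolding ord_x by blast
  qed
next
  assume "x \<noteq> 0 \<and> (\<exists>y. x = (- \<pi>) powi (ord x) * y\<^sup>2)"
  then obtain y where y: "x = (- \<pi>) powi (ord x) * y\<^sup>2" "y \<noteq> 0" by force
  show "x \<in> norm_group \<pi>"
  proof (cases "even (ord x)")
    case True
    then obtain m where "ord x = 2 * m" by blast
    then have "x = ((- \<pi>) powi m * y)\<^sup>2 - 0\<^sup>2 * \<pi>"
      using y by (simp add: power_mult_distrib pi_power_int_square)
    moreover have "((- \<pi>) powi m * y, 0) \<noteq> (0, 0)" using y by simp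
    ultimately show ?thesis unfolding norm_group_def by blast
  next
    case False
    then obtain m where "ord x = 2 * m + 1" by (auto elim: oddE)
    then have "x = 0\<^sup>2 - ((- \<pi>) powi m * y)\<^sup>2 * \<pi>"
      using y by (simp add: power_mult_distrib power_int_add pi_power_int_square mult.commute mult.left_commute)
    moreover have "(0, (- \<pi>) powi m * y) \<noteq> (0, 0)" using y by simp
    ultimately show ?thesis unfolding norm_group_def by blast
  qed
qed

lemma norm_group_nonzero: "x \<in> norm_group \<pi> \<Longrightarrow> x \<noteq> 0"
  by (simp add: norm_group_iff)

lemma norm_group_mult: "x \<in> norm_group \<pi> \<Longrightarrow> y \<in> norm_group \<pi> \<Longrightarrow> x * y \<in> norm_group \<pi>"
proof -
  assume xy: "x \<in> norm_group \<pi>" "y \<in> norm_group \<pi>"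
  then obtain u v where uv: "x = (- \<pi>) powi (ord x) * u\<^sup>2" "y = (- \<pi>) powi (ord y) * v\<^sup>2"
    unfolding norm_group_iff by blast
  have "x * y = (- \<pi>) powi (ord x + ord y) * (u * v)\<^sup>2"
    by (subst uv(1), subst uv(2)) (simp add: power_int_add power_mult_distrib)
  then show "x * y \<in> norm_group \<pi>"
    using xy ord_mult[of x y] unfolding norm_group_iff by (metis mult_eq_0_iff)
qed

lemma square_in_norm_group: "y \<noteq> 0 \<Longrightarrow> y\<^sup>2 \<in> norm_group \<pi>"
  unfolding norm_group_def by (intro CollectI exI[of _ y] exI[of _ 0]) simp

lemma norm_group_mult_iff:
  assumes "x \<in> norm_group \<pi>"
  shows "x * y \<in> norm_group \<pi> \<longleftrightarrow> y \<in> norm_group \<pi>"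
proof
  assume xy: "x * y \<in> norm_group \<pi>"
  have x: "x \<noteq> 0" using assms by (rule norm_group_nonzero)
  have "(inverse x)\<^sup>2 \<in> norm_group \<pi>"
    using x by (intro square_in_norm_group) simp
  from norm_group_mult[OF xy norm_group_mult[OF assms this]]
  have "(x * y) * (x * (inverse x)\<^sup>2) \<in> norm_group \<pi>" .
  also have "(x * y) * (x * (inverse x)\<^sup>2) = y"
    using x by (simp add: power2_eq_square field_simps)
  finally show "y \<in> norm_group \<pi>" .
qed (rule norm_group_mult[OF assms])

lemma pi_power_in_norm_group: "(- \<pi>) powi n \<in> norm_group \<pi>"
  unfolding norm_group_iff by (auto intro: exI[of _ 1])

lemma norm_group_unit_iff: "ord u = 0 \<Longrightarrow> u \<in> norm_group \<pi> \<longleftrightarrow> u \<noteq> 0 \<and> (\<exists>y. u = y\<^sup>2)"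
  by (simp add: norm_group_iff)

text \<open>The quotient \<open>y / x\<close> is a one-unit, hence a nonzero square. Membership
  therefore depends only on the order and the leading residue class, which makes it locally constant
  on shells.\<close>

lemma norm_group_stable:
  assumes "x \<noteq> 0" "y - x \<in> pideal (ord x + 1)"
  shows "y \<in> norm_group \<pi> \<longleftrightarrow> x \<in> norm_group \<pi>"
proof -
  have "x * (y / x - 1) = y - x" using assms(1) by (simp add: algebra_simps)
  then have 1: "y / x - 1 \<in> pideal 1"
    using assms pideal_mult_left_iff[of x "y / x - 1" "ord x + 1"] by simp
  from one_unit_is_square[OF two this] obtain z where z: "z\<^sup>2 = y / x" by blast
  have "y / x \<noteq> 0" using ord_eq_of_diff(1)[of 1 "y / x"] 1 by simp
  then have "z \<noteq> 0" using z by auto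
  from norm_group_mult_iff[OF square_in_norm_group[OF this], of x] show ?thesis
    using assms(1) by (simp add: z)
qed

lemma pi_decompose:
  assumes "x \<noteq> 0"
  obtains u where "x = (- \<pi>) powi (ord x) * u" "u \<noteq> 0" "ord u = 0"
    "x \<in> norm_group \<pi> \<longleftrightarrow> u \<in> norm_group \<pi>"
proof -
  define u where "u = x / (- \<pi>) powi (ord x)"
  have x: "x = (- \<pi>) powi (ord x) * u" by (simp add: u_def)
  moreover have "u \<noteq> 0" "ord u = 0" using assms by (simp_all add: u_def ord_divide)
  moreover have "x \<in> norm_group \<pi> \<longleftrightarrow> u \<in> norm_group \<pi>"
    using norm_group_mult_iff[OF pi_power_in_norm_group, of "ord x" u] x by simp
  ultimately show ?thesis by (rule that)
qed

section \<open>Squares among the residue classes, and the index of the norm group\<close>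

definition residue_squares :: "'k set" where
  "residue_squares = {r \<in> residue_units. r \<in> norm_group \<pi>}"

lemma finite_residue_squares [simp]: "finite residue_squares"
  by (simp add: residue_squares_def)

lemma norm_group_residue_rep:
  assumes "x \<noteq> 0" "ord x = 0"
  shows "residue_rep x \<in> norm_group \<pi> \<longleftrightarrow> x \<in> norm_group \<pi>"
proof (rule norm_group_stable)
  have "x \<in> pideal 0" using assms by (simp add: pideal_iff_ord)
  from residue_rep_diff[OF this] show "residue_rep x - x \<in> pideal (ord x + 1)"
    using assms pideal_diff_commute[of x] by simp
qed (fact assms)

lemma residue_rep_squares:
  assumes "x \<noteq> 0" "ord x = 0"
  shows "residue_rep x \<in> residue_squares \<longleftrightarrow> x \<in> norm_group \<pi>"
  using assms residue_rep_units[of x] norm_group_residue_rep[of x]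
  by (simp add: residue_squares_def pideal_iff_ord)

text \<open>With c the square of y, \<open>r\<^sup>2 - c\<close> factors, so primality of p leaves
  the classes of y and -y. They differ because \<open>2 * y\<close> is a unit.\<close>

lemma card_square_fibre:
  assumes c: "c \<in> residue_squares"
  shows "card {r \<in> residue_units. residue_rep (r\<^sup>2) = c} = 2"
proof -
  note cD = residue_unitsD[of c]
  have cU: "c \<in> residue_units" "c \<in> norm_group \<pi>" using c by (auto simp: residue_squares_def)
  then obtain y where y: "c = y\<^sup>2" using norm_group_unit_iff[OF cD(3)] by auto
  have y0: "y \<noteq> 0" using y cD cU by auto
  then have ord_y: "ord y = 0" using y cD(3) cU ord_power[of y 2] by simp
  then have yint: "y \<in> pideal 0" using y0 by (simp add: pideal_iff_ord)
  have eq: "residue_rep (r\<^sup>2) = c \<longleftrightarrow> r - y \<in> pideal 1 \<or> r + y \<in> pideal 1"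
    if r: "r \<in> residue_units" for r
  proof -
    have rint: "r \<in> pideal 0" using r by (rule residue_unitsD)
    then have r2: "r\<^sup>2 \<in> pideal 0" unfolding power2_eq_square by (intro pideal_mult_integral)
    have "residue_rep (r\<^sup>2) = c \<longleftrightarrow> r\<^sup>2 - c \<in> pideal 1"
      using residue_rep_eqI[OF r2 cD(1)[OF cU(1)]] residue_rep_diff[OF r2] by auto
    also have "r\<^sup>2 - c = (r - y) * (r + y)"
      by (simp add: y power2_eq_square algebra_simps)
    also have "\<dots> \<in> pideal 1 \<longleftrightarrow> r - y \<in> pideal 1 \<or> r + y \<in> pideal 1"
      using pideal_prime[OF pideal_diff[OF rint yint] pideal_add[OF rint yint]]
        pideal_mult_integral[OF pideal_diff[OF rint yint], of "r + y" 1]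
        pideal_mult_integral[OF pideal_add[OF rint yint], of "r - y" 1]
      by (auto simp: mult.commute)
    finally show ?thesis .
  qed
  have mem: "residue_rep y \<in> residue_units" "residue_rep (- y) \<in> residue_units"
    using residue_rep_units[of y] residue_rep_units[of "- y"] y0 ord_y
    by (simp_all add: pideal_iff_ord)
  have "{r \<in> residue_units. residue_rep (r\<^sup>2) = c} = {residue_rep y, residue_rep (- y)}"
  proof (intro set_eqI iffI)
    fix r assume r: "r \<in> {r \<in> residue_units. residue_rep (r\<^sup>2) = c}"
    then have "r - y \<in> pideal 1 \<or> r + y \<in> pideal 1" using eq by blast
    then show "r \<in> {residue_rep y, residue_rep (- y)}"
    proof
      assume "r - y \<in> pideal 1"
      then have "residue_rep y = r"
        using residue_rep_eqI[OF yint, of r] r residue_unitsD(1) pideal_diff_commute by blast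
      then show ?thesis by simp
    next
      assume "r + y \<in> pideal 1"
      then have "- y - r \<in> pideal 1"
        using pideal_diff_commute[of r "- y" 1] by simp
      then have "residue_rep (- y) = r"
        using residue_rep_eqI[of "- y" r] yint r residue_unitsD(1)[of r] by simp
      then show ?thesis by simp
    qed
  next
    fix r assume "r \<in> {residue_rep y, residue_rep (- y)}"
    then consider "r = residue_rep y" | "r = residue_rep (- y)" by blast
    then show "r \<in> {r \<in> residue_units. residue_rep (r\<^sup>2) = c}"
    proof cases
      case 1
      then have "r - y \<in> pideal 1" using residue_rep_diff[OF yint] pideal_diff_commute[of y] by simp
      with 1 mem eq show ?thesis by simp
    next
      case 2
      then have "- y - r \<in> pideal 1" using residue_rep_diff[of "- y"] yint by simp
      then have "r + y \<in> pideal 1" using pideal_diff_commute[of r "- y" 1] by simp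
      with 2 mem eq show ?thesis by simp
    qed
  qed
  moreover have "residue_rep y \<noteq> residue_rep (- y)"
  proof -
    have "2 * y \<notin> pideal 1"
      using y0 ord_y ord_two[OF two] by (simp add: pideal_iff_ord ord_mult)
    moreover have "y - (- y) = 2 * y" by simp
    ultimately show ?thesis using residue_rep_eq_iff[of y "- y"] yint by (simp only: pideal_minus_iff) blast
  qed
  ultimately show ?thesis by simp
qed

text \<open>Each square class has two roots. This is the bridge from sums over norms, which are sums
  over square classes, to quadratic Gauss sums.\<close>

lemma sum_residue_squares:
  fixes F :: "'k \<Rightarrow> complex"
  assumes F: "residue_class_function F"
  shows "(\<Sum>r\<in>residue_units. F (r\<^sup>2)) = 2 * (\<Sum>r\<in>residue_squares. F r)"
proof -
  have r2: "r\<^sup>2 \<in> pideal 0" "r\<^sup>2 \<noteq> 0" "ord (r\<^sup>2) = 0" if "r \<in> residue_units" for r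
    using residue_unitsD[OF that] by (simp_all add: pideal_iff_ord ord_power)
  have "(\<Sum>r\<in>residue_units. F (r\<^sup>2)) = (\<Sum>r\<in>residue_units. F (residue_rep (r\<^sup>2)))"
    using residue_class_function_rep[OF F r2(1)] by (intro sum.cong) auto
  also have "\<dots> = (\<Sum>c\<in>residue_squares. \<Sum>r\<in>{r \<in> residue_units. residue_rep (r\<^sup>2) = c}. F (residue_rep (r\<^sup>2)))"
  proof (rule sum.group[symmetric])
    show "(\<lambda>r. residue_rep (r\<^sup>2)) ` residue_units \<subseteq> residue_squares"
      using residue_rep_squares[OF r2(2,3)] square_in_norm_group residue_unitsD(2) by auto
  qed simp_all
  also have "\<dots> = (\<Sum>c\<in>residue_squares. 2 * F c)"
    by (intro sum.cong refl) (simp add: card_square_fibre)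
  finally show ?thesis by (simp add: sum_distrib_left)
qed

lemma card_residue_squares: "2 * card residue_squares = residue_order TYPE('k) - 1"
proof -
  have "residue_class_function (\<lambda>r::'k. 1 :: complex)" by (simp add: residue_class_function_def)
  from sum_residue_squares[OF this]
  have "complex_of_nat (card (residue_units :: 'k set)) = complex_of_nat (2 * card residue_squares)"
    by simp
  then show ?thesis
    by (simp only: of_nat_eq_iff card_residue_units)
qed

text \<open>The product of a non-square unit and a square is a non-square, and both sets have half
  of the units. The bijection serves twice: for the index of the norm group and for the sign change
  of the Gauss sum.\<close>

lemma bij_nonsquare_mult:
  assumes u: "u \<noteq> 0" "ord u = 0" "u \<notin> norm_group \<pi>"
  shows "bij_betw (\<lambda>r. residue_rep (u * r)) residue_squares (residue_units - residue_squares)"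
proof (rule residue_rep_bij)
  have sub: "residue_squares \<subseteq> residue_units" by (auto simp: residue_squares_def)
  show "card residue_squares = card (residue_units - residue_squares)"
    using card_residue_squares card_residue_units[where 'k = 'k] card_Diff_subset[OF _ sub] by simp
next
  fix r assume "r \<in> residue_squares"
  then have r: "r \<in> residue_units" "r \<in> norm_group \<pi>" by (auto simp: residue_squares_def)
  note rD = residue_unitsD[OF r(1)]
  have ur: "u * r \<noteq> 0" "ord (u * r) = 0" using u rD by (simp_all add: ord_mult)
  then show "u * r \<in> pideal 0" by (simp add: pideal_iff_ord)
  have "u * r \<notin> norm_group \<pi>"
    using norm_group_mult_iff[OF r(2), of u] u by (simp add: mult.commute)
  then show "residue_rep (u * r) \<in> residue_units - residue_squares"
    using residue_rep_squares[OF ur] residue_rep_units[of "u * r"] ur by (simp add: pideal_iff_ord)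
next
  fix r r' assume r: "r \<in> residue_squares" "r' \<in> residue_squares" "u * r - u * r' \<in> pideal 1"
  then have "r - r' \<in> pideal 1"
    using u pideal_mult_left_iff[of u "r - r'" 1] by (simp add: right_diff_distrib)
  with r show "r = r'"
    using residue_reps_unique[of r r'] residue_unitsD(1)[of r] residue_unitsD(1)[of r']
    by (simp add: residue_squares_def)
qed simp

text \<open>The norm group has index at most two, which makes \<open>sgn_char\<close>
  multiplicative. Stripping powers of \<open>- \<pi>\<close> leaves non-square units u and v; then v
  is congruent to \<open>u * r\<close> for a square r, and \<open>u * v\<close> to the norm
  \<open>u\<^sup>2 * r\<close>.\<close>

lemma norm_group_nonmember_mult:
  assumes "x \<noteq> 0" "y \<noteq> 0" "x \<notin> norm_group \<pi>" "y \<notin> norm_group \<pi>"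
  shows "x * y \<in> norm_group \<pi>"
proof -
  obtain u where u: "x = (- \<pi>) powi (ord x) * u" "u \<noteq> 0" "ord u = 0"
      "x \<in> norm_group \<pi> \<longleftrightarrow> u \<in> norm_group \<pi>"
    by (rule pi_decompose[OF assms(1)])
  obtain v where v: "y = (- \<pi>) powi (ord y) * v" "v \<noteq> 0" "ord v = 0"
      "y \<in> norm_group \<pi> \<longleftrightarrow> v \<in> norm_group \<pi>"
    by (rule pi_decompose[OF assms(2)])
  have u': "u \<notin> norm_group \<pi>" and v': "v \<notin> norm_group \<pi>"
    using assms u(4) v(4) by blast+
  have "residue_rep v \<in> residue_units - residue_squares"
    using residue_rep_squares[OF v(2,3)] residue_rep_units[of v] v(2,3) v' by (simp add: pideal_iff_ord)
  then have "residue_rep v \<in> (\<lambda>r. residue_rep (u * r)) ` residue_squares"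
    using bij_nonsquare_mult[OF u(2,3) u'] by (simp add: bij_betw_def)
  then obtain r where r: "r \<in> residue_squares" "residue_rep v = residue_rep (u * r)"
    by blast
  have rD: "r \<in> norm_group \<pi>" "r \<noteq> 0" "ord r = 0" using r residue_unitsD[of r] by (auto simp: residue_squares_def)
  have ur: "u * r \<noteq> 0" "ord (u * r) = 0" using u(2,3) rD by (simp_all add: ord_mult)
  have "v - u * r \<in> pideal 1"
    using residue_rep_eq_iff[of v "u * r"] r(2) v(2,3) ur by (simp add: pideal_iff_ord)
  then have "u * (v - u * r) \<in> pideal 1"
    using pideal_mult_left_iff[of u "v - u * r" 1] u(2,3) by simp
  moreover have "u * (v - u * r) = u * v - u\<^sup>2 * r" by (simp add: power2_eq_square algebra_simps)
  moreover have "u\<^sup>2 * r \<noteq> 0" "ord (u\<^sup>2 * r) = 0" using u(2,3) rD by (simp_all add: ord_mult ord_power)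
  ultimately have "u * v \<in> norm_group \<pi> \<longleftrightarrow> u\<^sup>2 * r \<in> norm_group \<pi>"
    using norm_group_stable[of "u\<^sup>2 * r" "u * v"] by simp
  then have "u * v \<in> norm_group \<pi>"
    using norm_group_mult[OF square_in_norm_group[OF u(2)] rD(1)] by simp
  then have mem: "((- \<pi>) powi (ord x) * (- \<pi>) powi (ord y)) * (u * v) \<in> norm_group \<pi>"
    using norm_group_mult pi_power_in_norm_group by simp
  have "x * y = ((- \<pi>) powi (ord x) * u) * ((- \<pi>) powi (ord y) * v)"
    by (rule arg_cong2[OF u(1) v(1)])
  also have "\<dots> = ((- \<pi>) powi (ord x) * (- \<pi>) powi (ord y)) * (u * v)"
    by (simp add: mult_ac)
  finally show ?thesis using mem by (rule ssubst)
qed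

lemma sgn_mult:
  assumes "x \<noteq> 0" "y \<noteq> 0"
  shows "sgn_char \<pi> (x * y) = sgn_char \<pi> x * sgn_char \<pi> y"
proof (cases "x \<in> norm_group \<pi>")
  case True
  then show ?thesis using norm_group_mult_iff[OF True, of y] by (simp add: sgn_char_def)
next
  case x: False
  show ?thesis
  proof (cases "y \<in> norm_group \<pi>")
    case True
    then show ?thesis
      using norm_group_mult_iff[OF True, of x] by (simp add: sgn_char_def mult.commute[of x y])
  next
    case False
    then show ?thesis
      using norm_group_nonmember_mult[OF assms x False] x by (simp add: sgn_char_def)
  qed
qed

lemma sgn_square_mult: "y \<noteq> 0 \<Longrightarrow> sgn_char \<pi> (y\<^sup>2 * x) = sgn_char \<pi> x"
  using norm_group_mult_iff[OF square_in_norm_group, of y x] by (simp add: sgn_char_def)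

lemma sgn_pi_mult: "sgn_char \<pi> ((- \<pi>) powi n * x) = sgn_char \<pi> x"
  using norm_group_mult_iff[OF pi_power_in_norm_group, of n x] by (simp add: sgn_char_def)

lemma sgn_self_mult [simp]: "sgn_char \<pi> x * sgn_char \<pi> x = 1"
  by (simp add: sgn_char_def)

end

section \<open>Gauss sums\<close>

text \<open>\<open>trivial\<close> and \<open>nontrivial\<close> fix h as the depth of \<Psi>. The
  \<open>LEAST\<close> over the integers in \<open>char_depth\<close> would give no information
  before a minimum is known to exist; the equality is \<open>char_depth_eq\<close>.\<close>

locale character_setting = ramified_setting \<pi> for \<pi> :: "'k::nonarch_local_field" +
  fixes \<Psi> :: "'k \<Rightarrow> complex" and h :: int and q :: real
  assumes q_def: "q = real (residue_order TYPE('k))"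
    and hom: "\<Psi> (x + y) = \<Psi> x * \<Psi> y"
    and trivial: "x \<in> pideal (h + 1) \<Longrightarrow> \<Psi> x = 1"
    and nontrivial: "\<exists>x\<in>pideal h. \<Psi> x \<noteq> 1"
begin

lemma q_gt_1: "q > 1"
  unfolding q_def by (rule residue_order_real_gt_1)

lemma q_pos [simp]: "q > 0" and q_nonneg [simp]: "q \<ge> 0" and q_nonzero [simp]: "q \<noteq> 0"
  using q_gt_1 by simp_all

lemma Psi_zero [simp]: "\<Psi> 0 = 1"
  by (simp add: trivial)

lemma Psi_add_cong: "y \<in> pideal (h + 1) \<Longrightarrow> \<Psi> (x + y) = \<Psi> x"
  by (simp add: hom trivial)

lemma Psi_cong: "x - y \<in> pideal (h + 1) \<Longrightarrow> \<Psi> x = \<Psi> y"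
  using Psi_add_cong[of "x - y" y] by simp

lemma Psi_class_function:
  assumes "v \<in> pideal h"
  shows "residue_class_function (\<lambda>r. \<Psi> (v * r))"
  unfolding residue_class_function_def
proof (intro ballI impI)
  fix x y :: 'k assume "x - y \<in> pideal 1"
  then show "\<Psi> (v * x) = \<Psi> (v * y)"
    using pideal_mult[OF assms, of "x - y" 1] by (intro Psi_cong) (simp add: right_diff_distrib)
qed

text \<open>Orthogonality: a shift by z with \<open>\<Psi> (v * z) \<noteq> 1\<close> permutes the
  classes and multiplies the sum by that value.\<close>

lemma sum_Psi_zero:
  assumes v: "v \<noteq> 0" "ord v = h"
  shows "(\<Sum>r\<in>residue_reps. \<Psi> (v * r)) = 0"
proof -
  obtain w where w: "w \<in> pideal h" "\<Psi> w \<noteq> 1" using nontrivial by blast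
  define z where "z = w / v"
  have w_eq: "w = v * z" using v by (simp add: z_def)
  have z: "z \<in> pideal 0"
    using w v pideal_mult_left_iff[of v z h] by (simp add: w_eq)
  have vp: "v \<in> pideal h" using v by (simp add: pideal_iff_ord)
  have "(\<Sum>r\<in>residue_reps. \<Psi> (v * (r + z))) = (\<Sum>r\<in>residue_reps. \<Psi> (v * r))"
  proof (rule sum_residue_bij[OF Psi_class_function[OF vp]])
    show int: "r + z \<in> pideal 0" if "r \<in> residue_reps" for r
      using that z residue_reps_integral pideal_add by blast
    show "residue_rep (r + z) \<in> residue_reps" if "r \<in> residue_reps" for r
      using int[OF that] by (rule residue_rep_in)
    show "r = r'" if "r \<in> residue_reps" "r' \<in> residue_reps" "r + z - (r' + z) \<in> pideal 1" for r r'
      using that residue_reps_unique[of r r'] by simp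
  qed simp_all
  moreover have "(\<Sum>r\<in>residue_reps. \<Psi> (v * (r + z))) = \<Psi> w * (\<Sum>r\<in>residue_reps. \<Psi> (v * r))"
    by (simp add: w_eq ring_distribs hom sum_distrib_left mult.commute)
  ultimately have "(\<Psi> w - 1) * (\<Sum>r\<in>residue_reps. \<Psi> (v * r)) = 0"
    by (simp add: left_diff_distrib)
  then show ?thesis using w by simp
qed

definition gauss :: "'k \<Rightarrow> complex" where
  "gauss v = (\<Sum>r\<in>residue_reps. \<Psi> (v * r\<^sup>2))"

lemma Psi_square_class_function:
  assumes "v \<in> pideal h"
  shows "residue_class_function (\<lambda>r. \<Psi> (v * r\<^sup>2))"
  unfolding residue_class_function_def
proof (intro ballI impI)
  fix x y :: 'k assume xy: "x \<in> pideal 0" "y \<in> pideal 0" "x - y \<in> pideal 1"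
  then have "(x + y) * (x - y) \<in> pideal 1" by (intro pideal_mult_integral pideal_add)
  then have "v * ((x + y) * (x - y)) \<in> pideal (h + 1)" using assms by (intro pideal_mult)
  moreover have "v * ((x + y) * (x - y)) = v * x\<^sup>2 - v * y\<^sup>2"
    by (simp add: power2_eq_square algebra_simps)
  ultimately show "\<Psi> (v * x\<^sup>2) = \<Psi> (v * y\<^sup>2)" by (intro Psi_cong) simp
qed

lemma sum_units_Psi_square:
  "v \<noteq> 0 \<Longrightarrow> ord v = h \<Longrightarrow> (\<Sum>r\<in>residue_units. \<Psi> (v * r\<^sup>2)) = gauss v - 1"
  using sum_residue_reps[OF Psi_square_class_function[of v]]
  by (simp add: gauss_def pideal_iff_ord)

text \<open>The \<open>- 1\<close> removes the zero class, and the half accounts for the two roots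
  of each square class.\<close>

lemma sum_squares_Psi:
  assumes v: "v \<noteq> 0" "ord v = h"
  shows "(\<Sum>r\<in>residue_squares. \<Psi> (v * r)) = (gauss v - 1) / 2"
  using sum_residue_squares[OF Psi_class_function[of v]] sum_units_Psi_square[OF v] v
  by (simp add: pideal_iff_ord)

lemma gauss_unit_square:
  assumes v: "v \<noteq> 0" "ord v = h" and y: "y \<noteq> 0" "ord y = 0"
  shows "gauss (y\<^sup>2 * v) = gauss v"
proof -
  have vp: "v \<in> pideal h" using v by (simp add: pideal_iff_ord)
  have "(\<Sum>r\<in>residue_reps. \<Psi> (v * (y * r)\<^sup>2)) = (\<Sum>r\<in>residue_reps. \<Psi> (v * r\<^sup>2))"
  proof (rule sum_residue_bij[OF Psi_square_class_function[OF vp]])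
    show int: "y * r \<in> pideal 0" if "r \<in> residue_reps" for r
      using that y residue_reps_integral[of r] by (simp add: pideal_mult_left_iff)
    show "residue_rep (y * r) \<in> residue_reps" if "r \<in> residue_reps" for r
      using int[OF that] by (rule residue_rep_in)
    show "r = r'" if r: "r \<in> residue_reps" "r' \<in> residue_reps" "y * r - y * r' \<in> pideal 1" for r r'
    proof -
      have "y * (r - r') \<in> pideal 1" using r(3) by (simp add: right_diff_distrib)
      then have "r - r' \<in> pideal 1" using y by (simp add: pideal_mult_left_iff)
      then show ?thesis using r by (intro residue_reps_unique)
    qed
  qed simp_all
  then show ?thesis by (simp add: gauss_def power_mult_distrib mult_ac)
qed

text \<open>For a non-square u, the sums over square classes belonging to v and to
  \<open>u * v\<close> together run over all units, hence add up to -1 by orthogonality. In terms of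
  Gauss sums this says that the two are opposite.\<close>

lemma gauss_unit_mult:
  assumes v: "v \<noteq> 0" "ord v = h" and u: "u \<noteq> 0" "ord u = 0"
  shows "gauss (u * v) = sgn_char \<pi> u * gauss v"
proof (cases "u \<in> norm_group \<pi>")
  case True
  then obtain y where y: "u = y\<^sup>2" using norm_group_unit_iff[OF u(2)] by auto
  then have "y \<noteq> 0" using u by auto
  moreover from this have "ord y = 0" using u ord_power[of y 2] y by simp
  ultimately show ?thesis using True gauss_unit_square[OF v] y by (simp add: sgn_char_def)
next
  case False
  have vp: "v \<in> pideal h" using v by (simp add: pideal_iff_ord)
  have uv: "u * v \<noteq> 0" "ord (u * v) = h" using u v by (simp_all add: ord_mult)
  have int: "r \<in> pideal 0" if "r \<in> residue_squares" for r
    using that residue_unitsD(4)[of r] by (simp add: residue_squares_def)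
  have "(\<Sum>r\<in>residue_squares. \<Psi> (u * v * r)) = (\<Sum>r\<in>residue_squares. \<Psi> (v * residue_rep (u * r)))"
  proof (rule sum.cong[OF refl])
    fix r assume "r \<in> residue_squares"
    then have "u * r \<in> pideal 0" using int u by (simp add: pideal_mult_left_iff)
    from residue_class_function_rep[OF Psi_class_function[OF vp] this]
    show "\<Psi> (u * v * r) = \<Psi> (v * residue_rep (u * r))" by (simp add: mult_ac)
  qed
  also have "\<dots> = (\<Sum>r\<in>residue_units - residue_squares. \<Psi> (v * r))"
    by (rule sum.reindex_bij_betw[OF bij_nonsquare_mult[OF u False]])
  finally have "(\<Sum>r\<in>residue_squares. \<Psi> (u * v * r)) + (\<Sum>r\<in>residue_squares. \<Psi> (v * r)) =
      (\<Sum>r\<in>residue_units. \<Psi> (v * r))"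
    using sum.subset_diff[of residue_squares residue_units "\<lambda>r. \<Psi> (v * r)"]
    by (simp add: residue_squares_def)
  also have "\<dots> = - 1"
    using sum_residue_reps[OF Psi_class_function[OF vp]] sum_Psi_zero[OF v]
    by (simp add: eq_neg_iff_add_eq_0 add.commute)
  finally have "(gauss (u * v) - 1) / 2 + (gauss v - 1) / 2 = - 1"
    by (simp only: sum_squares_Psi[OF v] sum_squares_Psi[OF uv])
  moreover have "gauss (u * v) + gauss v = 2 * ((gauss (u * v) - 1) / 2 + (gauss v - 1) / 2) + 2"
    by (simp add: diff_divide_distrib ring_distribs)
  ultimately have "gauss (u * v) + gauss v = 0" by simp
  then have "gauss (u * v) = - gauss v" by (simp only: eq_neg_iff_add_eq_0)
  then show ?thesis using False by (simp add: sgn_char_def)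
qed

text \<open>The substitution \<open>r \<mapsto> r + t\<close> turns \<open>r\<^sup>2 - t\<^sup>2\<close> into \<open>r\<^sup>2 + 2 r t\<close>, which is linear in \<open>t\<close>.\<close>

lemma gauss_mult_neg:
  assumes v: "v \<noteq> 0" "ord v = h"
  shows "gauss v * gauss (- v) = of_real q"
proof -
  have vp: "v \<in> pideal h" using v by (simp add: pideal_iff_ord)
  have shift: "(\<Sum>r\<in>residue_reps. \<Psi> (v * (r + t)\<^sup>2)) = gauss v" if t: "t \<in> residue_reps" for t
    unfolding gauss_def
  proof (rule sum_residue_bij[OF Psi_square_class_function[OF vp]])
    show int: "r + t \<in> pideal 0" if "r \<in> residue_reps" for r
      using that t residue_reps_integral pideal_add by blast
    show "residue_rep (r + t) \<in> residue_reps" if "r \<in> residue_reps" for r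
      using int[OF that] by (rule residue_rep_in)
    show "r = r'" if "r \<in> residue_reps" "r' \<in> residue_reps" "r + t - (r' + t) \<in> pideal 1" for r r'
      using that residue_reps_unique[of r r'] by simp
  qed simp_all
  have "gauss v * gauss (- v) = (\<Sum>t\<in>residue_reps. gauss v * \<Psi> (- v * t\<^sup>2))"
    by (simp add: gauss_def[of "- v"] sum_distrib_left)
  also have "\<dots> = (\<Sum>t\<in>residue_reps. \<Sum>r\<in>residue_reps. \<Psi> (v * r\<^sup>2) * \<Psi> (2 * v * r * t))"
  proof (rule sum.cong[OF refl])
    fix t :: 'k assume "t \<in> residue_reps"
    from shift[OF this] have "gauss v * \<Psi> (- v * t\<^sup>2) =
        (\<Sum>r\<in>residue_reps. \<Psi> (v * (r + t)\<^sup>2)) * \<Psi> (- v * t\<^sup>2)" by simp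
    also have "\<dots> = (\<Sum>r\<in>residue_reps. \<Psi> (v * (r + t)\<^sup>2 + - v * t\<^sup>2))"
      by (simp only: sum_distrib_right hom)
    also have "\<dots> = (\<Sum>r\<in>residue_reps. \<Psi> (v * r\<^sup>2 + 2 * v * r * t))"
      by (simp add: power2_eq_square algebra_simps)
    finally show "gauss v * \<Psi> (- v * t\<^sup>2) = (\<Sum>r\<in>residue_reps. \<Psi> (v * r\<^sup>2) * \<Psi> (2 * v * r * t))"
      by (simp only: hom)
  qed
  also have "\<dots> = (\<Sum>r\<in>residue_reps. \<Psi> (v * r\<^sup>2) * (\<Sum>t\<in>residue_reps. \<Psi> (2 * v * r * t)))"
    by (subst sum.swap) (simp add: sum_distrib_left)
  \<comment> \<open>The inner sum is linear in t. For a unit r its coefficient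
    \<open>2 * v * r\<close> still has order h, so orthogonality leaves only the zero class.\<close>
  also have "\<dots> = (\<Sum>r\<in>residue_reps. if r = residue_rep (0 :: 'k) then of_real q else 0)"
  proof (rule sum.cong[OF refl])
    fix r :: 'k assume r: "r \<in> residue_reps"
    show "\<Psi> (v * r\<^sup>2) * (\<Sum>t\<in>residue_reps. \<Psi> (2 * v * r * t)) =
        (if r = residue_rep 0 then of_real q else 0)"
    proof (cases "r = residue_rep 0")
      case True
      then have r1: "r \<in> pideal 1" using residue_rep_diff[of "0 :: 'k"] by simp
      have *: "x * (v * r) \<in> pideal (h + 1)" if "x \<in> pideal 0" for x
        by (rule pideal_mult_integral[OF that pideal_mult[OF vp r1]])
      have "\<Psi> (2 * v * r * t) = 1" if t: "t \<in> residue_reps" for t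
      proof -
        have "2 * t \<in> pideal 0"
          using residue_reps_integral[OF t] ord_two[OF two] by (simp add: pideal_mult_left_iff)
        from *[OF this] show ?thesis by (intro trivial) (simp add: mult_ac)
      qed
      moreover have "\<Psi> (v * r\<^sup>2) = 1"
        using *[OF residue_reps_integral[OF r]] by (intro trivial) (simp add: power2_eq_square mult_ac)
      ultimately show ?thesis using True card_residue_reps[where 'a = 'k] by (simp add: q_def)
    next
      case False
      then have "r \<in> residue_units" using r by (simp add: residue_reps_split)
      then have "2 * v * r \<noteq> 0" "ord (2 * v * r) = h"
        using v residue_unitsD[of r] ord_two[OF two] by (simp_all add: ord_mult)
      then show ?thesis using sum_Psi_zero[of "2 * v * r"] False by simp
    qed
  qed
  also have "\<dots> = of_real q"
    using residue_rep_in[of "0 :: 'k"] by simp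
  finally show ?thesis .
qed

lemma char_depth_eq: "char_depth \<Psi> = h"
  unfolding char_depth_def
proof (rule Least_equality)
  fix i assume i: "\<forall>x\<in>pideal (i + 1). \<Psi> x = 1"
  show "h \<le> i"
  proof (rule ccontr)
    assume "\<not> h \<le> i"
    then have "x \<in> pideal (i + 1)" if "x \<in> pideal h" for x :: 'k
      using pideal_mono[OF that] by simp
    then show False using i nontrivial by blast
  qed
qed (simp add: trivial)

abbreviation G :: complex where "G \<equiv> gauss_G \<pi> \<Psi>"

abbreviation Q :: complex where "Q \<equiv> of_real (sqrt q)"

lemma Q_nonzero [simp]: "Q \<noteq> 0"
  by simp

lemma Q_square: "Q\<^sup>2 = of_real q"
  by (simp flip: of_real_power)

lemma gauss_G_eq: "gauss ((- \<pi>) powi h) = Q * G"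
proof -
  have "G = of_real (q powr (- 1 / 2)) * gauss ((- \<pi>) powi h)"
    unfolding gauss_G_def gauss_def char_depth_eq residue_reps_def
    by (simp add: sum.reindex[OF inj_residue_field_some] q_def)
  moreover have "q powr (- 1 / 2) = inverse (sqrt q)"
    by (simp add: powr_minus powr_half_sqrt)
  ultimately show ?thesis by simp
qed

lemma gauss_eq:
  assumes v: "v \<noteq> 0" "ord v = h"
  shows "gauss v = Q * sgn_char \<pi> v * G"
proof -
  obtain u where u: "v = (- \<pi>) powi (ord v) * u" "u \<noteq> 0" "ord u = 0"
    by (rule pi_decompose[OF v(1)])
  have v_eq: "v = (- \<pi>) powi h * u" using u(1) unfolding v(2) .
  have "gauss v = gauss (u * (- \<pi>) powi h)"
    using arg_cong[OF v_eq, of gauss] by (simp only: mult.commute)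
  also have "\<dots> = sgn_char \<pi> u * (Q * G)"
    using gauss_unit_mult[of "(- \<pi>) powi h" u] u(2,3) gauss_G_eq by simp
  also have "sgn_char \<pi> u = sgn_char \<pi> v"
    unfolding v_eq by (rule sgn_pi_mult[symmetric])
  finally show ?thesis by simp
qed

text \<open>The Gauss sums of v and -v have product q and differ by the factor sgn(-1); G is
  normalised so that the q cancels.\<close>

lemma G_square: "G * G = sgn_char \<pi> (- 1)"
proof -
  let ?v = "(- \<pi>) powi h"
  have "gauss (- ?v) = sgn_char \<pi> (- 1) * gauss ?v"
    using gauss_unit_mult[of ?v "- 1"] by simp
  then have "(Q * G) * (sgn_char \<pi> (- 1) * (Q * G)) = of_real q"
    using gauss_mult_neg[of ?v] by (simp add: gauss_G_eq)
  moreover have "(Q * G) * (sgn_char \<pi> (- 1) * (Q * G)) = Q\<^sup>2 * (sgn_char \<pi> (- 1) * (G * G))"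
    by (simp only: power2_eq_square mult_ac)
  ultimately have "of_real q * (sgn_char \<pi> (- 1) * (G * G)) = of_real q * 1"
    by (simp only: Q_square mult_1_right)
  then have "sgn_char \<pi> (- 1) * (G * G) = 1"
    by (subst (asm) mult_cancel_left) simp
  then have "sgn_char \<pi> (- 1) * (sgn_char \<pi> (- 1) * (G * G)) = sgn_char \<pi> (- 1)" by simp
  then show ?thesis by (simp only: sgn_self_mult mult_1_left flip: mult.assoc)
qed

end

section \<open>Integrals over cosets and shells\<close>

text \<open>Partition of c + p^j into q balls of level j + 1, indexed by the leading digit of
  \<open>(x - c) / u\<close>. The volumes and the integrals below rest on it.\<close>

lemma mem_coset_split:
  fixes c u :: "'k::nonarch_local_field"
  assumes u: "u \<noteq> 0" "ord u = j" and r: "r \<in> residue_reps"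
  shows "x \<in> coset (c + u * r) (j + 1) \<longleftrightarrow> x \<in> coset c j \<and> r = residue_rep ((x - c) / u)"
proof -
  let ?z = "(x - c) / u"
  have z: "u * ?z = x - c" using u by simp
  have 1: "x \<in> coset (c + u * r) (j + 1) \<longleftrightarrow> ?z - r \<in> pideal 1"
  proof -
    have "x - (c + u * r) = u * (?z - r)" using z by (simp add: right_diff_distrib)
    then show ?thesis using u pideal_mult_left_iff[of u "?z - r" "j + 1"] by (simp add: coset_def)
  qed
  have 2: "x \<in> coset c j \<longleftrightarrow> ?z \<in> pideal 0"
    using u pideal_mult_left_iff[of u ?z j] unfolding z by (simp add: coset_def)
  have "?z \<in> pideal 0" if "?z - r \<in> pideal 1"
    using pideal_add[OF pideal_mono[OF that, of 0] residue_reps_integral[OF r]] by simp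
  moreover have "?z - r \<in> pideal 1 \<longleftrightarrow> r = residue_rep ?z" if "?z \<in> pideal 0"
    using residue_rep_eqI[OF that r] residue_rep_diff[OF that] by auto
  ultimately show ?thesis using 1 2 by blast
qed

lemma sum_coset_split:
  fixes c u :: "'k::nonarch_local_field" and a :: "'b::comm_monoid_add"
  assumes u: "u \<noteq> 0" "ord u = j"
  shows "(\<Sum>r\<in>residue_reps. if x \<in> coset (c + u * r) (j + 1) then a else 0) =
    (if x \<in> coset c j then a else 0)"
proof (cases "x \<in> coset c j")
  case True
  have "(x - c) / u \<in> pideal 0"
    using True u pideal_mult_left_iff[of u "(x - c) / u" j] by (simp add: coset_def)
  then have "residue_rep ((x - c) / u) \<in> residue_reps" by (rule residue_rep_in)
  then show ?thesis using True by (simp add: mem_coset_split[OF u] cong: sum.cong)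
qed (simp add: mem_coset_split[OF u] cong: sum.cong)

lemma shell_subset_coset: "shell l \<subseteq> coset 0 l"
  by (auto simp: shell_def coset_def pideal_def)

lemma shell_iff_coset: "x \<in> shell l \<longleftrightarrow> x \<in> coset 0 l \<and> x \<notin> coset 0 (l + 1)"
  by (auto simp: shell_def coset_def pideal_def)

lemma coset_subset_shell:
  assumes "c \<in> shell l" "l < m"
  shows "coset c m \<subseteq> shell l"
proof
  fix x assume "x \<in> coset c m"
  then have "x - c \<in> pideal (ord c + 1)"
    using assms pideal_mono[of "x - c" m] by (simp add: coset_def shell_def)
  then show "x \<in> shell l" using assms ord_eq_of_diff[of c x] by (simp add: shell_def)
qed

locale integral_setting = character_setting \<pi> \<Psi> h q
  for \<pi> :: "'k::nonarch_local_field" and \<Psi> and h and q +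
  fixes \<mu> :: "'k measure"
  assumes haar: "normalised_haar \<mu>"
begin

lemma sets_mu [measurable_cong, simp]: "sets \<mu> = sets borel"
  using haar by (simp add: normalised_haar_def)

lemma coset_in_sets [simp]: "coset (c :: 'k) j \<in> sets borel"
  by (intro borel_open open_coset)

lemma emeasure_coset_translate: "emeasure \<mu> (coset c j) = emeasure \<mu> (coset 0 j)"
proof -
  have "coset c j = (\<lambda>x. c + x) ` coset 0 j"
    by (auto simp: coset_def image_iff intro!: bexI[of _ "_ - c"])
  moreover have "emeasure \<mu> ((\<lambda>x. c + x) ` coset 0 j) = emeasure \<mu> (coset 0 j)"
    using haar coset_in_sets unfolding normalised_haar_def by blast
  ultimately show ?thesis by simp
qed

lemma emeasure_coset_step: "emeasure \<mu> (coset 0 j) = ennreal q * emeasure \<mu> (coset 0 (j + 1))"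
proof -
  obtain u :: 'k where u: "u \<noteq> 0" "ord u = j" using ord_surj by blast
  have "emeasure \<mu> (coset 0 j) = (\<integral>\<^sup>+x. indicator (coset 0 j) x \<partial>\<mu>)"
    by simp
  also have "\<dots> = (\<integral>\<^sup>+x. (\<Sum>r\<in>residue_reps. indicator (coset (0 + u * r) (j + 1)) x) \<partial>\<mu>)"
    using sum_coset_split[OF u, of _ 0 "1 :: ennreal"]
    by (intro nn_integral_cong) (simp add: indicator_def of_bool_def)
  also have "\<dots> = (\<Sum>r\<in>residue_reps. emeasure \<mu> (coset (0 + u * r) (j + 1)))"
    by (subst nn_integral_sum) (simp_all add: borel_measurable_indicator)
  also have "\<dots> = (\<Sum>r\<in>(residue_reps :: 'k set). emeasure \<mu> (coset 0 (j + 1)))"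
    by (intro sum.cong refl emeasure_coset_translate)
  also have "\<dots> = ennreal q * emeasure \<mu> (coset 0 (j + 1))"
    using card_residue_reps[where 'a = 'k] by (simp add: q_def ennreal_of_nat_eq_real_of_nat)
  finally show ?thesis .
qed

text \<open>Induction from the integers in both directions; passing to smaller balls cancels the
  finite nonzero factor q in \<open>ennreal\<close>.\<close>

lemma emeasure_coset: "emeasure \<mu> (coset c j) = ennreal (q powi (- j))"
proof -
  have "emeasure \<mu> (coset 0 j) = ennreal (q powi (- j))"
  proof (induction j rule: int_induct[where k = 0])
    case base
    then show ?case using haar by (simp add: normalised_haar_def coset_zero)
  next
    case (step1 i)
    have "q powi (- i) = q * q powi (- (i + 1))"
      using power_int_add_1'[of q "- (i + 1)"] by simp
    then have "ennreal q * ennreal (q powi (- (i + 1))) = ennreal q * emeasure \<mu> (coset 0 (i + 1))"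
      using step1 emeasure_coset_step[of i] by (simp flip: ennreal_mult)
    then show ?case by (subst (asm) ennreal_mult_cancel_left) auto
  next
    case (step2 i)
    have "q powi (- (i - 1)) = q * q powi (- i)"
      using power_int_add_1'[of q "- i"] by (simp add: add.commute)
    then show ?case using step2 emeasure_coset_step[of "i - 1"] by (simp add: ennreal_mult)
  qed
  then show ?thesis by (simp only: emeasure_coset_translate[of c])
qed

text \<open>A relation rather than a value: integrability travels with it, so that splitting into
  sub-balls creates no separate integrability goals.\<close>

definition coset_integral :: "('k \<Rightarrow> complex) \<Rightarrow> 'k \<Rightarrow> int \<Rightarrow> complex \<Rightarrow> bool" where
  "coset_integral f c j I \<longleftrightarrow>
     has_bochner_integral \<mu> (\<lambda>x. indicator (coset c j) x *\<^sub>R f x) I"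

lemma coset_integral_const:
  assumes "\<And>x. x \<in> coset c j \<Longrightarrow> f x = a"
  shows "coset_integral f c j (of_real (q powi (- j)) * a)"
proof -
  have "has_bochner_integral \<mu> (indicator (coset c j) :: 'k \<Rightarrow> real) (measure \<mu> (coset c j))"
    by (rule has_bochner_integral_real_indicator) (simp_all add: emeasure_coset)
  then have "has_bochner_integral \<mu> (\<lambda>x. (indicator (coset c j) x :: real) *\<^sub>R a)
      (measure \<mu> (coset c j) *\<^sub>R a)"
    by (rule has_bochner_integral_scaleR_left)
  moreover have "(\<lambda>x. (indicator (coset c j) x :: real) *\<^sub>R a) = (\<lambda>x. indicator (coset c j) x *\<^sub>R f x)"
    using assms by (intro ext) (simp add: indicator_scaleR_eq_if)
  moreover have "measure \<mu> (coset c j) *\<^sub>R a = of_real (q powi (- j)) * a"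
    by (simp add: measure_def emeasure_coset scaleR_conv_of_real)
  ultimately show ?thesis by (simp add: coset_integral_def)
qed

lemma coset_integral_split:
  assumes u: "u \<noteq> 0" "ord u = j"
    and I: "\<And>r. r \<in> residue_reps \<Longrightarrow> coset_integral f (c + u * r) (j + 1) (I r)"
  shows "coset_integral f c j (\<Sum>r\<in>residue_reps. I r)"
proof -
  have "(\<Sum>r\<in>residue_reps. indicator (coset (c + u * r) (j + 1)) x *\<^sub>R f x) =
      indicator (coset c j) x *\<^sub>R f x" for x
    using sum_coset_split[OF u, of x c "f x"]
    by (simp add: indicator_scaleR_eq_if)
  moreover have "has_bochner_integral \<mu>
      (\<lambda>x. \<Sum>r\<in>residue_reps. indicator (coset (c + u * r) (j + 1)) x *\<^sub>R f x) (\<Sum>r\<in>residue_reps. I r)"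
    using I unfolding coset_integral_def by (intro has_bochner_integral_sum)
  ultimately show ?thesis by (simp add: coset_integral_def)
qed

lemma coset_integral_locally_constant:
  assumes u: "u \<noteq> 0" "ord u = j"
    and f: "\<And>r x. r \<in> residue_reps \<Longrightarrow> x \<in> coset (c + u * r) (j + 1) \<Longrightarrow> f x = F r"
  shows "coset_integral f c j (of_real (q powi (- (j + 1))) * (\<Sum>r\<in>residue_reps. F r))"
  unfolding sum_distrib_left
  by (intro coset_integral_split[OF u] coset_integral_const f)

text \<open>Because \<open>ord b + m = h\<close>, the character \<open>\<Psi> (b * (x - c))\<close>
  depends only on the residue digit of x at level m and is non-trivial in it, so orthogonality
  applies.\<close>

lemma coset_integral_character:
  assumes b: "b \<noteq> 0" "ord b + m = h"
    and f: "\<And>x. x \<in> coset c m \<Longrightarrow> f x = a * \<Psi> (b * (x - c))"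
  shows "coset_integral f c m 0"
proof -
  obtain u :: 'k where u: "u \<noteq> 0" "ord u = m" using ord_surj by blast
  have bu: "b * u \<noteq> 0" "ord (b * u) = h" using b u by (simp_all add: ord_mult)
  have loc: "f x = a * \<Psi> (b * u * r)" if r: "r \<in> residue_reps" and x: "x \<in> coset (c + u * r) (m + 1)" for r x
  proof -
    have "x \<in> coset c m" using mem_coset_split[OF u r] x by blast
    then have "f x = a * \<Psi> (b * (x - c))" by (rule f)
    also have "b * (x - (c + u * r)) \<in> pideal (h + 1)"
      using x b by (simp add: coset_def pideal_mult_left_iff flip: b(2))
    then have "b * (x - c) - b * u * r \<in> pideal (h + 1)"
      by (simp add: algebra_simps)
    then have "\<Psi> (b * (x - c)) = \<Psi> (b * u * r)" by (rule Psi_cong)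
    finally show ?thesis .
  qed
  have "coset_integral f c m
      (of_real (q powi (- (m + 1))) * (\<Sum>r\<in>residue_reps. a * \<Psi> (b * u * r)))"
    by (rule coset_integral_locally_constant[OF u loc])
  then show ?thesis by (simp add: sum_Psi_zero[OF bu] flip: sum_distrib_left)
qed

text \<open>Cancellation at the fine level m is carried up to the coarse level j, one splitting per
  induction step.\<close>

lemma coset_integral_zero_descend:
  assumes "j \<le> m" "\<And>c'. c' \<in> coset c j \<Longrightarrow> coset_integral f c' m 0"
  shows "coset_integral f c j 0"
  using assms
proof (induction "nat (m - j)" arbitrary: c j)
  case 0
  then show ?case by (simp add: coset_def)
next
  case (Suc n)
  obtain u :: 'k where u: "u \<noteq> 0" "ord u = j" using ord_surj by blast
  have "coset_integral f (c + u * r) (j + 1) 0" if r: "r \<in> residue_reps" for r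
  proof (rule Suc.hyps(1))
    show "n = nat (m - (j + 1))" "j + 1 \<le> m" using Suc.hyps(2) by auto
    fix c' assume "c' \<in> coset (c + u * r) (j + 1)"
    then show "coset_integral f c' m 0" using mem_coset_split[OF u r] Suc.prems(2) by blast
  qed
  from coset_integral_split[OF u this] show ?case by simp
qed

section \<open>Integrals over shells\<close>

definition shell_integral :: "int \<Rightarrow> ('k \<Rightarrow> complex) \<Rightarrow> complex \<Rightarrow> bool" where
  "shell_integral l f I \<longleftrightarrow> has_bochner_integral \<mu> (\<lambda>x. indicator (shell l) x *\<^sub>R f x) I"

lemma shell_integral_iff: "shell_integral l f I \<longleftrightarrow> coset_integral (\<lambda>x. indicator (shell l) x *\<^sub>R f x) 0 l I"
proof -
  have "(\<lambda>x. indicator (coset 0 l) x *\<^sub>R indicator (shell l) x *\<^sub>R f x) = (\<lambda>x. indicator (shell l) x *\<^sub>R f x)"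
    using shell_subset_coset by (intro ext) (auto simp: indicator_scaleR_eq_if)
  then show ?thesis by (simp add: shell_integral_def coset_integral_def)
qed

lemma shell_integral_locally_constant:
  assumes u: "u \<noteq> 0" "ord u = l"
    and f: "\<And>r x. r \<in> residue_units \<Longrightarrow> x \<in> coset (u * r) (l + 1) \<Longrightarrow> f x = F r"
  shows "shell_integral l f (of_real (q powi (- (l + 1))) * (\<Sum>r\<in>residue_units. F r))"
proof -
  \<comment> \<open>Extension by zero to the zero class, whose sub-ball p^(l+1) misses the
    shell.\<close>
  have "(\<Sum>r\<in>residue_units. F r) = (\<Sum>r\<in>residue_reps. if r \<in> residue_units then F r else 0)"
    by (rule sum.mono_neutral_cong_left) (auto simp: residue_units_def)
  moreover have "coset_integral (\<lambda>x. indicator (shell l) x *\<^sub>R f x) 0 l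
    (of_real (q powi (- (l + 1))) * (\<Sum>r\<in>residue_reps. if r \<in> residue_units then F r else 0))"
  proof (rule coset_integral_locally_constant[OF u])
    fix r x :: 'k assume r: "r \<in> residue_reps" and x: "x \<in> coset (0 + u * r) (l + 1)"
    show "indicator (shell l) x *\<^sub>R f x = (if r \<in> residue_units then F r else 0)"
    proof (cases "r \<in> residue_units")
      case True
      have "u * r \<in> shell l" using u residue_unitsD[OF True] by (simp add: shell_def ord_mult)
      then have "x \<in> shell l" using coset_subset_shell[of "u * r" l "l + 1"] x by auto
      then show ?thesis using True f[OF True] x by simp
    next
      case False
      then have "u * r \<in> pideal (l + 1)"
        using r u pideal_mult[of u l r 1] by (simp add: residue_units_def pideal_iff_ord)
      then have "x \<in> coset 0 (l + 1)"
        using x pideal_add[of "x - u * r" "l + 1" "u * r"] by (simp add: coset_def)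
      then have "x \<notin> shell l" by (simp add: shell_iff_coset)
      then show ?thesis using False by simp
    qed
  qed
  ultimately show ?thesis by (simp add: shell_integral_iff)
qed

text \<open>Non-stationary phase. Near each c the function is a constant times a character in
  \<open>x - c\<close>, and m is the level at which that character is non-trivial but already
  constant on sub-balls of the next level. As \<open>l < m\<close>, the shell is a union of such
  balls.\<close>

lemma shell_integral_zero:
  assumes m: "l < m"
    and f: "\<And>c. c \<in> shell l \<Longrightarrow> \<exists>b. b \<noteq> 0 \<and> ord b + m = h \<and> (\<forall>x\<in>coset c m. f x = f c * \<Psi> (b * (x - c)))"
  shows "shell_integral l f 0"
  unfolding shell_integral_iff
proof (rule coset_integral_zero_descend[where m = m])
  fix c :: 'k assume c: "c \<in> coset 0 l"
  show "coset_integral (\<lambda>x. indicator (shell l) x *\<^sub>R f x) c m 0"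
  proof (cases "c \<in> shell l")
    case True
    obtain b where b: "b \<noteq> 0" "ord b + m = h" and fb: "\<And>x. x \<in> coset c m \<Longrightarrow> f x = f c * \<Psi> (b * (x - c))"
      using f[OF True] by blast
    show ?thesis
    proof (rule coset_integral_character[OF b])
      fix x assume x: "x \<in> coset c m"
      then have "x \<in> shell l" using coset_subset_shell[OF True m] by blast
      then show "indicator (shell l) x *\<^sub>R f x = f c * \<Psi> (b * (x - c))"
        using fb[OF x] by simp
    qed
  next
    case False
    then have c1: "c \<in> pideal (l + 1)" using c by (simp add: shell_iff_coset) (simp add: coset_def)
    have "indicator (shell l) x *\<^sub>R f x = 0" if "x \<in> coset c m" for x
    proof -
      have "x - c \<in> pideal (l + 1)" using that m pideal_mono[of "x - c" m "l + 1"] by (simp add: coset_def)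
      then have "x \<in> coset 0 (l + 1)" using pideal_add[OF _ c1, of "x - c"] by (simp add: coset_def)
      then show ?thesis by (simp add: shell_iff_coset)
    qed
    from coset_integral_const[OF this] show ?thesis by simp
  qed
qed (use m in simp)

lemma shell_integral_cong:
  assumes "\<And>x. x \<in> shell l \<Longrightarrow> f x = g x" "shell_integral l g I"
  shows "shell_integral l f I"
proof -
  have "(\<lambda>x. indicator (shell l) x *\<^sub>R f x) = (\<lambda>x. indicator (shell l) x *\<^sub>R g x)"
    using assms(1) by (intro ext) (simp add: indicator_scaleR_eq_if)
  with assms(2) show ?thesis by (simp add: shell_integral_def)
qed

lemma shell_integral_eq: "shell_integral l f I \<Longrightarrow> (LINT x:shell l|\<mu>. f x) = I"
  unfolding shell_integral_def set_lebesgue_integral_def by (rule has_bochner_integral_integral_eq)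

lemma shell_integral_mult_measure:
  assumes "shell_integral n f I"
  shows "(LINT x:shell n|mult_measure \<mu>. f x) = of_real (q powi n) * I"
proof -
  have absv: "absv = (\<lambda>x :: 'k. dist x 0)" by (auto simp: dist_absv)
  have meas: "(\<lambda>x :: 'k. inverse (absv x)) \<in> borel_measurable \<mu>"
    unfolding absv measurable_cong_sets[OF sets_mu refl]
    by (intro borel_measurable_inverse borel_measurable_continuous_onI continuous_intros)
  have nonneg: "0 \<le> inverse (absv x)" for x :: 'k by (simp add: absv)
  note I = assms[unfolded shell_integral_def]
  have "(LINT x:shell n|mult_measure \<mu>. f x) =
      (LINT x|\<mu>. inverse (absv x) *\<^sub>R (indicator (shell n) x *\<^sub>R f x))"
    unfolding set_lebesgue_integral_def mult_measure_def
    using I meas nonneg by (intro integral_density) (auto dest: borel_measurable_has_bochner_integral)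
  also have "\<dots> = (LINT x|\<mu>. of_real (q powi n) * (indicator (shell n) x *\<^sub>R f x))"
    by (intro Bochner_Integration.integral_cong refl)
      (auto simp: indicator_def shell_def absv_def q_def power_int_minus scaleR_conv_of_real)
  also have "\<dots> = of_real (q powi n) * I"
    by (simp only: integral_mult_right_zero has_bochner_integral_integral_eq[OF I])
  finally show ?thesis .
qed

section \<open>The quadratic Gauss integral over t\<close>

lemma ord_double: "a \<noteq> 0 \<Longrightarrow> c \<noteq> 0 \<Longrightarrow> ord (2 * a * c) = ord a + ord (c :: 'k)"
  using ord_two[OF two] by (simp add: ord_mult)

text \<open>At c the phase has derivative \<open>2 * a * c\<close> of order
  \<open>ord a + l\<close>, which dictates m. The second-order term has order at least
  \<open>ord a + 2 * m\<close>, and this exceeds h exactly because \<open>ord a + 2 * l < h\<close>.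
  The factor K will be the part of the integrand without t.\<close>

lemma quadratic_shell_integral_zero:
  assumes a: "a \<noteq> 0" and l: "ord a + 2 * l < h"
  shows "shell_integral l (\<lambda>t. K * \<Psi> (a * t\<^sup>2)) 0"
proof (rule shell_integral_zero[where m = "h - ord a - l"])
  fix c :: 'k assume "c \<in> shell l"
  then have c: "c \<noteq> 0" "ord c = l" by (simp_all add: shell_def)
  show "\<exists>b. b \<noteq> 0 \<and> ord b + (h - ord a - l) = h \<and>
      (\<forall>x\<in>coset c (h - ord a - l). K * \<Psi> (a * x\<^sup>2) = K * \<Psi> (a * c\<^sup>2) * \<Psi> (b * (x - c)))"
  proof (intro exI[of _ "2 * a * c"] conjI ballI)
    show "2 * a * c \<noteq> 0" using a c ord_two[OF two] by simp
    show "ord (2 * a * c) + (h - ord a - l) = h" using ord_double[OF a c(1)] c by simp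
    fix x assume x: "x \<in> coset c (h - ord a - l)"
    define w where "w = x - c"
    have w: "w \<in> pideal (h - ord a - l)" using x by (simp add: w_def coset_def)
    have "a * (w * w) \<in> pideal (h + 1)"
      by (rule pideal_scale[OF a pideal_mult[OF w w]]) (use l in simp)
    then have "\<Psi> (a * c\<^sup>2 + 2 * a * c * w + a * (w * w)) = \<Psi> (a * c\<^sup>2 + 2 * a * c * w)"
      by (rule Psi_add_cong)
    moreover have "a * x\<^sup>2 = a * c\<^sup>2 + 2 * a * c * w + a * (w * w)"
      by (simp add: w_def power2_eq_square algebra_simps)
    ultimately show "K * \<Psi> (a * x\<^sup>2) = K * \<Psi> (a * c\<^sup>2) * \<Psi> (2 * a * c * (x - c))"
      by (simp add: hom w_def)
  qed
qed (use l in simp)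

lemma quadratic_shell_integral:
  assumes a: "a \<noteq> 0" and l: "h \<le> ord a + 2 * l"
  shows "shell_integral l (\<lambda>t. K * \<Psi> (a * t\<^sup>2))
    (of_real (q powi (- (l + 1))) * (\<Sum>r\<in>residue_units. K * \<Psi> (a * ((- \<pi>) powi l)\<^sup>2 * r\<^sup>2)))"
proof (rule shell_integral_locally_constant)
  let ?u = "(- \<pi>) powi l"
  show "?u \<noteq> 0" "ord ?u = l" by simp_all
  fix r x :: 'k assume r: "r \<in> residue_units" and x: "x \<in> coset (?u * r) (l + 1)"
  define c where "c = ?u * r"
  have "c \<noteq> 0" "ord c = l" using residue_unitsD[OF r] by (simp_all add: c_def ord_mult)
  then have c: "c \<in> pideal l" by (simp add: pideal_iff_ord)
  have w: "x - c \<in> pideal (l + 1)" using x by (simp add: coset_def c_def)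
  have "(x - c) + (c + c) \<in> pideal l"
    by (intro pideal_add c pideal_mono[OF w]) simp
  moreover have "(x - c) + (c + c) = x + c" by simp
  ultimately have "x + c \<in> pideal l" by metis
  then have "a * ((x - c) * (x + c)) \<in> pideal (h + 1)"
    using pideal_scale[OF a pideal_mult[OF w, of "x + c" l], of "h + 1"] l by simp
  moreover have "a * ((x - c) * (x + c)) = a * x\<^sup>2 - a * ?u\<^sup>2 * r\<^sup>2"
    by (simp add: c_def power2_eq_square algebra_simps)
  ultimately have "\<Psi> (a * x\<^sup>2) = \<Psi> (a * ?u\<^sup>2 * r\<^sup>2)" by (intro Psi_cong) simp
  then show "K * \<Psi> (a * x\<^sup>2) = K * \<Psi> (a * ?u\<^sup>2 * r\<^sup>2)" by simp
qed

text \<open>If \<open>ord a + 2 * l > h\<close>, then \<Psi> is trivial on the shell and the volume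
  remains. Equality, possible for one l at most and only if \<open>h - ord a\<close> is even, gives
  a Gauss sum without its zero class.\<close>

lemma quadratic_shell_value:
  assumes a: "a \<noteq> 0"
  shows "(LINT t:shell l|\<mu>. K * \<Psi> (a * t\<^sup>2)) = K *
    (if ord a + 2 * l < h then 0
     else of_real (q powi (- (l + 1))) *
       (if ord a + 2 * l = h then Q * sgn_char \<pi> a * G - 1 else of_real (q - 1)))"
proof (cases "ord a + 2 * l < h")
  case True
  then show ?thesis using shell_integral_eq[OF quadratic_shell_integral_zero[OF a True]] by simp
next
  case False
  let ?v = "a * ((- \<pi>) powi l)\<^sup>2"
  have v: "?v \<noteq> 0" "ord ?v = ord a + 2 * l" using a by (simp_all add: ord_mult ord_power)
  have "(\<Sum>r\<in>residue_units. \<Psi> (?v * r\<^sup>2)) =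
      (if ord a + 2 * l = h then Q * sgn_char \<pi> a * G - 1 else of_real (q - 1))"
  proof (cases "ord a + 2 * l = h")
    case True
    have "sgn_char \<pi> ?v = sgn_char \<pi> a"
      using sgn_square_mult[of "(- \<pi>) powi l" a] by (simp add: mult.commute)
    then show ?thesis using True sum_units_Psi_square[of ?v] gauss_eq[of ?v] v by simp
  next
    case gt: False
    have "\<Psi> (?v * r\<^sup>2) = 1" if "r \<in> residue_units" for r
    proof (rule trivial)
      have "?v * r\<^sup>2 \<noteq> 0" "ord (?v * r\<^sup>2) = ord a + 2 * l"
        using v residue_unitsD[OF that] by (simp_all add: ord_mult ord_power)
      then show "?v * r\<^sup>2 \<in> pideal (h + 1)" using False gt by (simp add: pideal_iff_ord)
    qed
    moreover have "of_nat (card (residue_units :: 'k set)) = (of_real (q - 1) :: complex)"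
      using residue_order_gt_1[where 'k = 'k] by (simp add: card_residue_units q_def of_nat_diff)
    ultimately show ?thesis using gt by simp
  qed
  then show ?thesis
    using False shell_integral_eq[OF quadratic_shell_integral[OF a, of l K]]
    by (simp flip: sum_distrib_left)
qed

text \<open>The terms are the volumes of the shells that make up the ball p^L, and the sum is the
  volume of that ball.\<close>

lemma geometric_tail_has_sum:
  "((\<lambda>l. of_real (q powi (- (l + 1)) * (q - 1))) has_sum (of_real (q powi (- L)) :: complex)) {L..}"
proof -
  have "(\<lambda>n. (1 / q) ^ n) sums (1 / (1 - 1 / q))"
    using q_gt_1 by (intro geometric_sums) simp
  from sums_mult[OF this, of "q powi (- (L + 1)) * (q - 1)"]
  have "(\<lambda>n. q powi (- (L + 1)) * (q - 1) * (1 / q) ^ n) sums (q powi (- L))"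
  proof -
    have "q powi (- L) = q powi (- (L + 1)) * q" using power_int_add_1[of q "- (L + 1)"] by simp
    also have "\<dots> = q powi (- (L + 1)) * ((q - 1) * (1 / (1 - 1 / q)))"
      using q_gt_1 by (simp add: field_simps)
    finally show ?thesis using \<open>_ sums (q powi (- (L + 1)) * (q - 1) * _)\<close> by (simp only: mult.assoc)
  qed
  moreover have "q powi (- (L + int n + 1)) * (q - 1) = q powi (- (L + 1)) * (q - 1) * (1 / q) ^ n" for n
  proof -
    have "q powi (- (L + 1) + - int n) = q powi (- (L + 1)) * q powi (- int n)"
      by (rule power_int_add) simp
    moreover have "- (L + 1) + - int n = - (L + int n + 1)" by simp
    moreover have "q powi (- int n) = (1 / q) ^ n"
      by (simp add: power_int_minus power_one_over inverse_eq_divide)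
    ultimately show ?thesis by (simp only: mult_ac)
  qed
  ultimately have "(\<lambda>n. q powi (- (L + int n + 1)) * (q - 1)) sums (q powi (- L))"
    by (simp only:)
  then have "((\<lambda>n. q powi (- (L + int n + 1)) * (q - 1)) has_sum (q powi (- L))) UNIV"
    using q_gt_1 by (intro sums_nonneg_imp_has_sum) simp_all
  moreover have "bij_betw (\<lambda>n. L + int n) UNIV {L..}"
    by (rule bij_betwI[where g = "\<lambda>l. nat (l - L)"]) auto
  ultimately have "((\<lambda>l. q powi (- (l + 1)) * (q - 1)) has_sum (q powi (- L))) {L..}"
    using has_sum_reindex_bij_betw[of "\<lambda>n. L + int n" UNIV "{L..}" "\<lambda>l. q powi (- (l + 1)) * (q - 1)"]
    by (simp only:)
  then show ?thesis by (rule has_sum_of_real)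
qed

lemma Q_powi_even: "Q powi (2 * n) = of_real (q powi n)"
  using Q_square by (simp add: power_int_mult)

text \<open>Here \<open>Q powi (ord a - h - 1)\<close> is \<open>\<bar>a\<bar>\<^bsup>-1/2\<^esup> q\<^bsup>-(h+1)/2\<^esup>\<close>; all half-integral powers of \<open>q\<close> are
  written as integral powers of \<open>Q = \<surd>q\<close>.\<close>

lemma quadratic_gauss_integral:
  assumes a: "a \<noteq> 0"
  shows "(\<Sum>\<^sub>\<infinity>l\<in>UNIV. LINT t:shell l|\<mu>. K * \<Psi> (a * t\<^sup>2)) =
    K * (Q powi (ord a - h - 1) * (if even (h - ord a) then sgn_char \<pi> a * G else 1))"
proof -
  define F where "F l = (if ord a + 2 * l < h then 0 else of_real (q powi (- (l + 1))) *
       (if ord a + 2 * l = h then Q * sgn_char \<pi> a * G - 1 else of_real (q - 1)))" for l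
  have "(F has_sum (Q powi (ord a - h - 1) * (if even (h - ord a) then sgn_char \<pi> a * G else 1))) UNIV"
  proof (cases "even (h - ord a)")
    case True
    then obtain L where L: "h - ord a = 2 * L" by blast
    have "(F has_sum (of_real (q powi (- (L + 1))))) {L + 1..}"
      by (rule has_sum_cong[THEN iffD1, OF _ geometric_tail_has_sum]) (use L in \<open>simp add: F_def\<close>)
    then have "(F has_sum (F L + of_real (q powi (- (L + 1))))) (insert L {L + 1..})"
      by (rule has_sum_insert[rotated]) simp
    then have "(F has_sum (F L + of_real (q powi (- (L + 1))))) UNIV"
      by (rule has_sum_cong_neutral[THEN iffD1, rotated -1]) (use L in \<open>auto simp: F_def\<close>)
    \<comment> \<open>The volume of p^(L+1), contributed by all later shells, restores the zero
      class missing from the Gauss sum on shell L: the \<open>- 1\<close> cancels exactly.\<close>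
    moreover have "F L + of_real (q powi (- (L + 1))) = of_real (q powi (- (L + 1))) * (Q * (sgn_char \<pi> a * G))"
      using L by (simp add: F_def algebra_simps)
    moreover have "of_real (q powi (- (L + 1))) * (Q * (sgn_char \<pi> a * G)) = Q powi (ord a - h - 1) * (sgn_char \<pi> a * G)"
    proof -
      have "ord a - h - 1 = 2 * (- (L + 1)) + 1" using L by simp
      then have "Q powi (ord a - h - 1) = of_real (q powi (- (L + 1))) * Q"
        by (simp only: power_int_add_1 Q_powi_even Q_nonzero simp_thms)
      then show ?thesis by simp
    qed
    ultimately show ?thesis using True by (simp only: if_True)
  next
    case False
    then obtain L where L: "h - ord a = 2 * L + 1" by (rule oddE)
    have "(F has_sum (of_real (q powi (- (L + 1))))) {L + 1..}"
      by (rule has_sum_cong[THEN iffD1, OF _ geometric_tail_has_sum]) (use L in \<open>auto simp: F_def\<close>)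
    then have "(F has_sum (of_real (q powi (- (L + 1))))) UNIV"
      by (rule has_sum_cong_neutral[THEN iffD1, rotated -1]) (use L in \<open>auto simp: F_def\<close>)
    moreover have "Q powi (ord a - h - 1) = of_real (q powi (- (L + 1)))"
    proof -
      have "ord a - h - 1 = 2 * (- (L + 1))" using L by simp
      then show ?thesis by (simp only: Q_powi_even)
    qed
    ultimately show ?thesis using False by (simp only: if_False mult_1_right)
  qed
  from has_sum_cmult_right[OF this, of K]
  show ?thesis unfolding quadratic_shell_value[OF a] F_def by (rule infsumI)
qed

end

section \<open>The integral over the norms in a shell\<close>

locale mock_setting = integral_setting \<pi> \<Psi> h q \<mu>
  for \<pi> :: "'k::nonarch_local_field" and \<Psi> and h and q and \<mu> +
  fixes s \<theta> :: 'k
  assumes s: "s \<noteq> 0" and \<theta>: "\<theta> \<noteq> 0"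
    and depth: "2 * h \<le> 2 * ord s + ord \<theta>"
begin

text \<open>The integrand that remains after the t-integral has been split off; on the norms of one
  shell that integral contributes, besides the phase kept here, only a constant.\<close>

definition kernel :: "'k \<Rightarrow> complex" where
  "kernel x = indicator (norm_group \<pi>) x * \<Psi> (s * (x * \<theta> + inverse x * \<pi>))"

lemma norm_group_indicator_coset:
  assumes "c \<in> shell n" "n < m" "x \<in> coset c m"
  shows "indicator (norm_group \<pi>) x = (indicator (norm_group \<pi>) c :: complex)"
proof -
  have "x - c \<in> pideal (ord c + 1)"
    using assms pideal_mono[of "x - c" m] by (simp add: coset_def shell_def)
  then show ?thesis
    using assms(1) norm_group_stable[of c x] by (simp add: shell_def indicator_def)
qed

lemma inverse_diff_pideal:
  assumes "c \<in> shell n" "n < m" "x \<in> coset c m"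
  shows "inverse x - inverse c \<in> pideal (m - 2 * n)"
proof -
  have x: "x \<in> shell n" using coset_subset_shell[OF assms(1,2)] assms(3) by blast
  have nz: "x \<noteq> 0" "c \<noteq> 0" "ord x = n" "ord c = n" using x assms(1) by (simp_all add: shell_def)
  have "inverse x - inverse c = - (inverse (x * c) * (x - c))"
    using nz by (simp add: field_simps)
  moreover have "inverse (x * c) * (x - c) \<in> pideal (m - 2 * n)"
    by (rule pideal_scale[of _ _ m]) (use nz assms(3) in \<open>simp_all add: ord_inverse ord_mult coset_def\<close>)
  ultimately show ?thesis by simp
qed

lemma kernel_shell_integral_zero_left:
  assumes n: "ord s + n + ord \<theta> < h"
  shows "shell_integral n kernel 0"
\<comment> \<open>This m makes the linear phase \<open>s * \<theta> * (x - c)\<close> just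
  non-trivial. At this scale the change of \<open>\<pi> / x\<close> is invisible to \<Psi>, because
  \<open>depth\<close> together with the bound on n gives
  \<open>2 * n + ord \<theta> < 0\<close>.\<close>
proof (rule shell_integral_zero[where m = "h - ord s - ord \<theta>"])
  let ?m = "h - ord s - ord \<theta>"
  show nm: "n < ?m" using n by simp
  fix c :: 'k assume c: "c \<in> shell n"
  show "\<exists>b. b \<noteq> 0 \<and> ord b + ?m = h \<and> (\<forall>x\<in>coset c ?m. kernel x = kernel c * \<Psi> (b * (x - c)))"
  proof (intro exI[of _ "s * \<theta>"] conjI ballI)
    show "s * \<theta> \<noteq> 0" "ord (s * \<theta>) + ?m = h" using s \<theta> by (simp_all add: ord_mult)
    fix x assume x: "x \<in> coset c ?m"
    have "(s * \<pi>) * (inverse x - inverse c) \<in> pideal (h + 1)"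
      by (rule pideal_scale[OF _ inverse_diff_pideal[OF c nm x]])
        (use s n depth in \<open>simp_all add: ord_mult\<close>)
    then have "\<Psi> (s * (x * \<theta> + inverse x * \<pi>)) =
        \<Psi> (s * (c * \<theta> + inverse c * \<pi>) + s * \<theta> * (x - c))"
      by (intro Psi_cong) (simp add: algebra_simps)
    then show "kernel x = kernel c * \<Psi> (s * \<theta> * (x - c))"
      using norm_group_indicator_coset[OF c nm x] by (simp add: kernel_def hom)
  qed
qed

lemma kernel_shell_integral_zero_right:
  assumes n: "ord s - n + 1 < h"
  shows "shell_integral n kernel 0"
proof (rule shell_integral_zero[where m = "2 * n + h - ord s - 1"])
  let ?m = "2 * n + h - ord s - 1"
  show nm: "n < ?m" using n by simp
  fix c :: 'k assume c: "c \<in> shell n"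
  then have c': "c \<noteq> 0" "ord c = n" by (simp_all add: shell_def)
  \<comment> \<open>The derivative of \<open>s * \<pi> / x\<close> at c; m is h minus its order. The
    exact remainder of the linear expansion of \<open>1 / x\<close> is
    \<open>(x - c)\<^sup>2 / (x * c\<^sup>2)\<close>, and now the \<theta> term is the invisible
    one.\<close>
  let ?b = "- (s * \<pi> * inverse (c * c))"
  show "\<exists>b. b \<noteq> 0 \<and> ord b + ?m = h \<and> (\<forall>x\<in>coset c ?m. kernel x = kernel c * \<Psi> (b * (x - c)))"
  proof (intro exI[of _ ?b] conjI ballI)
    show "?b \<noteq> 0" "ord ?b + ?m = h" using s c' by (simp_all add: ord_mult ord_inverse)
    fix x assume x: "x \<in> coset c ?m"
    then have w: "x - c \<in> pideal ?m" by (simp add: coset_def)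
    have x': "x \<noteq> 0" "ord x = n"
      using x coset_subset_shell[OF c nm] by (auto simp: shell_def)
    have "(s * \<pi> * inverse (x * c * c)) * ((x - c) * (x - c)) \<in> pideal (h + 1)"
      by (rule pideal_scale[OF _ pideal_mult[OF w w]])
        (use s c' x' n in \<open>simp_all add: ord_mult ord_inverse\<close>)
    moreover have "(s * \<theta>) * (x - c) \<in> pideal (h + 1)"
      by (rule pideal_scale[OF _ w]) (use s \<theta> n depth in \<open>simp_all add: ord_mult\<close>)
    moreover have "s * (x * \<theta> + inverse x * \<pi>) - (s * (c * \<theta> + inverse c * \<pi>) + ?b * (x - c)) =
        (s * \<pi> * inverse (x * c * c)) * ((x - c) * (x - c)) + (s * \<theta>) * (x - c)"
      using c' x' by (simp add: field_simps)
    ultimately have "\<Psi> (s * (x * \<theta> + inverse x * \<pi>)) =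
        \<Psi> (s * (c * \<theta> + inverse c * \<pi>) + ?b * (x - c))"
      by (intro Psi_cong) (simp only: pideal_add)
    then have "\<Psi> (s * (x * \<theta> + inverse x * \<pi>)) =
        \<Psi> (s * (c * \<theta> + inverse c * \<pi>)) * \<Psi> (?b * (x - c))"
      by (simp only: hom)
    then show "kernel x = kernel c * \<Psi> (?b * (x - c))"
      by (simp only: kernel_def norm_group_indicator_coset[OF c nm x] mult.assoc)
  qed
qed

lemma kernel_shell_integral:
  assumes n: "h \<le> ord s + n + ord \<theta>" "h \<le> ord s - n + 1"
  shows "shell_integral n kernel (of_real (q powi (- (n + 1))) *
    (\<Sum>r\<in>residue_squares. \<Psi> (s * \<theta> * (- \<pi>) powi n * r - s * (- \<pi>) powi (1 - n) * inverse r)))"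
proof -
  let ?u = "(- \<pi>) powi n"
  let ?F = "\<lambda>r. if r \<in> residue_squares
    then \<Psi> (s * \<theta> * ?u * r - s * (- \<pi>) powi (1 - n) * inverse r) else 0"
  have "shell_integral n kernel (of_real (q powi (- (n + 1))) * (\<Sum>r\<in>residue_units. ?F r))"
  proof (rule shell_integral_locally_constant)
    show "?u \<noteq> 0" "ord ?u = n" by simp_all
    fix r x :: 'k assume r: "r \<in> residue_units" and x: "x \<in> coset (?u * r) (n + 1)"
    define c where "c = ?u * r"
    note rD = residue_unitsD[OF r]
    have c: "c \<in> shell n" using rD by (simp add: shell_def c_def ord_mult)
    have xc: "x \<in> coset c (n + 1)" using x by (simp add: c_def)
    have "indicator (norm_group \<pi>) x = (indicator (norm_group \<pi>) c :: complex)"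
      by (rule norm_group_indicator_coset[OF c _ xc]) simp
    also have "\<dots> = indicator residue_squares r"
      using r norm_group_mult_iff[OF pi_power_in_norm_group, of n r]
      by (simp add: c_def residue_squares_def indicator_def)
    finally have ind: "indicator (norm_group \<pi>) x = (indicator residue_squares r :: complex)" .
    have "(s * \<theta>) * (x - c) \<in> pideal (h + 1)"
      by (rule pideal_scale[of _ _ "n + 1"]) (use s \<theta> n xc in \<open>simp_all add: ord_mult coset_def\<close>)
    moreover have "(s * \<pi>) * (inverse x - inverse c) \<in> pideal (h + 1)"
      by (rule pideal_scale[OF _ inverse_diff_pideal[OF c _ xc]])
        (use s n in \<open>simp_all add: ord_mult\<close>)
    ultimately have "(s * \<theta>) * (x - c) + (s * \<pi>) * (inverse x - inverse c) \<in> pideal (h + 1)"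
      by (rule pideal_add)
    then have "\<Psi> (s * (x * \<theta> + inverse x * \<pi>)) = \<Psi> (s * (c * \<theta> + inverse c * \<pi>))"
      by (intro Psi_cong) (simp add: algebra_simps)
    \<comment> \<open>Writing \<open>\<pi>\<close> as minus \<open>- \<pi>\<close> produces the
      minus sign and the exponent \<open>1 - n\<close>.\<close>
    moreover have "s * (c * \<theta> + inverse c * \<pi>) = s * \<theta> * ?u * r - s * (- \<pi>) powi (1 - n) * inverse r"
      by (simp add: c_def power_int_diff field_simps)
    ultimately show "kernel x = ?F r"
      by (simp only: kernel_def ind) (simp add: indicator_def)
  qed
  moreover have "(\<Sum>r\<in>residue_units. ?F r) = (\<Sum>r\<in>residue_squares. ?F r)"
    by (rule sum.mono_neutral_right) (auto simp: residue_squares_def)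
  ultimately show ?thesis by simp
qed

text \<open>Inversion permutes the square classes. It is needed at the upper border, where the
  surviving phase is a multiple of \<open>1 / r\<close>.\<close>

lemma sum_squares_Psi_inverse:
  assumes v: "v \<noteq> 0" "ord v = h"
  shows "(\<Sum>r\<in>residue_squares. \<Psi> (v * inverse r)) = (\<Sum>r\<in>residue_squares. \<Psi> (v * r))"
proof (rule sum_residue_bij[OF Psi_class_function])
  have inv: "r \<noteq> 0" "ord r = 0" "r \<in> norm_group \<pi>" "inverse r \<noteq> 0" "ord (inverse r) = 0"
    if "r \<in> residue_squares" for r
    using that residue_unitsD[of r] by (auto simp: residue_squares_def ord_inverse)
  show "v \<in> pideal h" using v by (simp add: pideal_iff_ord)
  show "inverse r \<in> pideal 0" if "r \<in> residue_squares" for r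
    using inv[OF that] by (simp add: pideal_iff_ord)
  show "r = r'" if r: "r \<in> residue_squares" "r' \<in> residue_squares" "inverse r - inverse r' \<in> pideal 1" for r r'
  proof -
    note i = inv[OF r(1)] and i' = inv[OF r(2)]
    have "(r * r') * (inverse r - inverse r') \<in> pideal 1"
      by (rule pideal_scale[OF _ r(3)]) (use i i' in \<open>simp_all add: ord_mult\<close>)
    moreover have "(r * r') * (inverse r - inverse r') = r' - r" using i i' by (simp add: field_simps)
    ultimately have "r' - r \<in> pideal 1" by simp
    then show ?thesis
      using r residue_reps_unique[of r' r] by (simp add: residue_squares_def residue_units_def)
  qed
  show "residue_rep (inverse r) \<in> residue_squares" if "r \<in> residue_squares" for r
  proof -
    note i = inv[OF that]
    have "r * inverse r \<in> norm_group \<pi>" using i square_in_norm_group[of 1] by simp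
    then have "inverse r \<in> norm_group \<pi>" using norm_group_mult_iff[OF i(3)] by blast
    then show ?thesis using residue_rep_squares[OF i(4,5)] by simp
  qed
qed simp_all

text \<open>The integral of the kernel over \<open>shell n\<close> with respect to \<open>d\<^sup>\<times>x\<close>, which is \<open>q\<^sup>n dx\<close> there.\<close>

definition kernel_value :: "int \<Rightarrow> complex" where
  "kernel_value n =
    (if n = ord s - h + 1 then (Q * sgn_char \<pi> (- s) * G - 1) / of_real (2 * q)
     else if n = h - ord s - ord \<theta> then (Q * sgn_char \<pi> (s * \<theta>) * G - 1) / of_real (2 * q)
     else if h - ord s - ord \<theta> < n \<and> n \<le> ord s - h then of_real ((q - 1) / (2 * q)) else 0)"

lemma kernel_shell_value:
  "shell_integral n kernel (of_real (q powi (- n)) * kernel_value n)"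
proof -
  have q_power: "of_real (q powi (- (n + 1))) * z = of_real (q powi (- n)) * (z / of_real q)" for z :: complex
  proof -
    have "q powi (- n) = q powi (- (n + 1)) * q"
      using power_int_add_1[of q "- (n + 1)"] by simp
    then show ?thesis by simp
  qed
  consider "ord s + n + ord \<theta> < h" | "ord s - n + 1 < h"
    | "h \<le> ord s + n + ord \<theta>" "h \<le> ord s - n + 1" by linarith
  then show ?thesis
  proof cases
    case 1
    then have "kernel_value n = 0" using depth by (simp add: kernel_value_def)
    with kernel_shell_integral_zero_left[OF 1] show ?thesis by simp
  next
    case 2
    then have "kernel_value n = 0" using depth by (simp add: kernel_value_def)
    with kernel_shell_integral_zero_right[OF 2] show ?thesis by simp
  next
    case 3
    define a where "a = s * \<theta> * (- \<pi>) powi n"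
    define b where "b = (- \<pi>) powi (1 - n) * (- s)"
    have a: "a \<noteq> 0" "ord a = ord s + n + ord \<theta>" "sgn_char \<pi> a = sgn_char \<pi> (s * \<theta>)"
      using s \<theta> sgn_pi_mult[of n "s * \<theta>"] by (simp_all add: a_def ord_mult mult.commute)
    have b: "b \<noteq> 0" "ord b = ord s - n + 1" "sgn_char \<pi> b = sgn_char \<pi> (- s)"
      using s sgn_pi_mult[of "1 - n" "- s"] unfolding b_def by (simp_all add: ord_mult)
    have int: "a * r \<in> pideal (ord s + n + ord \<theta>)" "b * inverse r \<in> pideal (ord s - n + 1)"
      if "r \<in> residue_squares" for r
      using that residue_unitsD[of r] a b
      by (auto simp: residue_squares_def pideal_iff_ord ord_mult ord_inverse)
    have "(\<Sum>r\<in>residue_squares. \<Psi> (a * r + b * inverse r)) / of_real q = kernel_value n"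
    proof (cases "n = ord s - h + 1")
      case True
      \<comment> \<open>Here \<open>ord a = 2 * ord s + ord \<theta> - h + 1\<close>, which is at
        least \<open>h + 1\<close> by \<open>depth\<close>, so the term linear in r drops
        out.\<close>
      have "\<Psi> (a * r + b * inverse r) = \<Psi> (b * inverse r)" if "r \<in> residue_squares" for r
        using Psi_add_cong[OF pideal_mono[OF int(1)[OF that]], of "b * inverse r"] True depth
        by (simp add: add.commute)
      then have "(\<Sum>r\<in>residue_squares. \<Psi> (a * r + b * inverse r)) =
          (\<Sum>r\<in>residue_squares. \<Psi> (b * inverse r))" by simp
      also have "\<dots> = (Q * sgn_char \<pi> (- s) * G - 1) / 2"
        using True b sum_squares_Psi_inverse[of b] sum_squares_Psi[of b] gauss_eq[of b] by simp
      finally have "(\<Sum>r\<in>residue_squares. \<Psi> (a * r + b * inverse r)) / of_real q =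
          (Q * sgn_char \<pi> (- s) * G - 1) / 2 / of_real q" by (simp only:)
      then show ?thesis using True by (simp add: kernel_value_def)
    next
      case nt: False
      then have n2: "n \<le> ord s - h" using 3 by simp
      have b1: "\<Psi> (a * r + b * inverse r) = \<Psi> (a * r)" if "r \<in> residue_squares" for r
        using Psi_add_cong[OF pideal_mono[OF int(2)[OF that]], of "a * r"] n2 by simp
      show ?thesis
      proof (cases "n = h - ord s - ord \<theta>")
        case True
        have "(\<Sum>r\<in>residue_squares. \<Psi> (a * r + b * inverse r)) =
            (\<Sum>r\<in>residue_squares. \<Psi> (a * r))" using b1 by simp
        also have "\<dots> = (Q * sgn_char \<pi> (s * \<theta>) * G - 1) / 2"
          using True a sum_squares_Psi[of a] gauss_eq[of a] by simp
        finally have "(\<Sum>r\<in>residue_squares. \<Psi> (a * r + b * inverse r)) / of_real q =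
            (Q * sgn_char \<pi> (s * \<theta>) * G - 1) / 2 / of_real q" by (simp only:)
        then show ?thesis using True nt by (simp add: kernel_value_def)
      next
        case False
        have "\<Psi> (a * r) = 1" if "r \<in> residue_squares" for r
          by (rule trivial[OF pideal_mono[OF int(1)[OF that]]]) (use False 3 in simp)
        then have "(\<Sum>r\<in>residue_squares. \<Psi> (a * r + b * inverse r)) = of_nat (card residue_squares)"
          using b1 by simp
        also have "\<dots> = of_real ((q - 1) / 2)"
        proof -
          have "2 * real (card residue_squares) = q - 1"
            using arg_cong[OF card_residue_squares, of real] residue_order_gt_1[where 'k = 'k]
            by (simp add: q_def of_nat_diff)
          then have "real (card residue_squares) = (q - 1) / 2" by simp
          then show ?thesis by (metis of_real_of_nat_eq)
        qed
        finally have "(\<Sum>r\<in>residue_squares. \<Psi> (a * r + b * inverse r)) / of_real q =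
            of_real ((q - 1) / 2) / of_real q" by (simp only:)
        then show ?thesis using False nt n2 3 by (simp add: kernel_value_def)
      qed
    qed
    moreover have "s * \<theta> * (- \<pi>) powi n * r - s * (- \<pi>) powi (1 - n) * inverse r = a * r + b * inverse r" for r
      by (simp add: a_def b_def)
    ultimately show ?thesis
      using kernel_shell_integral[OF 3] by (simp only: q_power)
  qed
qed

text \<open>The Gauss integral in \<open>t\<close> for \<open>a = - s / x\<close> with \<open>x \<in> shell n\<close> a norm.\<close>

definition shell_factor :: "int \<Rightarrow> complex" where
  "shell_factor n = Q powi (ord s - n - h - 1) *
    (if even (ord s - h - n) then sgn_char \<pi> (- s) * G else 1)"

lemma mock_shell_value:
  "(LINT x:shell n|mult_measure \<mu>. indicator (norm_group \<pi>) x *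
      (\<Sum>\<^sub>\<infinity>l\<in>UNIV. LINT t:shell l|\<mu>. \<Psi> (s * (x * \<theta> + inverse x * \<pi> - inverse x * t\<^sup>2)))) =
    kernel_value n * shell_factor n"
proof -
  have "shell_integral n (\<lambda>x. indicator (norm_group \<pi>) x *
      (\<Sum>\<^sub>\<infinity>l\<in>UNIV. LINT t:shell l|\<mu>. \<Psi> (s * (x * \<theta> + inverse x * \<pi> - inverse x * t\<^sup>2))))
      (of_real (q powi (- n)) * kernel_value n * shell_factor n)"
  proof (rule shell_integral_cong)
    fix x :: 'k assume "x \<in> shell n"
    then have x: "x \<noteq> 0" "ord x = n" by (simp_all add: shell_def)
    show "indicator (norm_group \<pi>) x *
      (\<Sum>\<^sub>\<infinity>l\<in>UNIV. LINT t:shell l|\<mu>. \<Psi> (s * (x * \<theta> + inverse x * \<pi> - inverse x * t\<^sup>2))) =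
      kernel x * shell_factor n"
    proof (cases "x \<in> norm_group \<pi>")
      case True
      define a where "a = - s * inverse x"
      have a: "a \<noteq> 0" "ord a = ord s - n" using s x by (simp_all add: a_def ord_mult ord_inverse)
      have "x * a = - s" using x by (simp add: a_def)
      then have sgn: "sgn_char \<pi> a = sgn_char \<pi> (- s)"
        using norm_group_mult_iff[OF True, of a] by (simp add: sgn_char_def)
      have "\<Psi> (s * (x * \<theta> + inverse x * \<pi> - inverse x * t\<^sup>2)) =
          \<Psi> (s * (x * \<theta> + inverse x * \<pi>)) * \<Psi> (a * t\<^sup>2)" for t
        by (simp add: a_def algebra_simps flip: hom)
      then have "(\<Sum>\<^sub>\<infinity>l\<in>UNIV. LINT t:shell l|\<mu>. \<Psi> (s * (x * \<theta> + inverse x * \<pi> - inverse x * t\<^sup>2))) =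
          \<Psi> (s * (x * \<theta> + inverse x * \<pi>)) *
            (Q powi (ord a - h - 1) * (if even (h - ord a) then sgn_char \<pi> a * G else 1))"
        by (simp only: quadratic_gauss_integral[OF a(1)])
      also have "Q powi (ord a - h - 1) * (if even (h - ord a) then sgn_char \<pi> a * G else 1) = shell_factor n"
      proof -
        have "even (h - ord a) \<longleftrightarrow> even (ord s - h - n)" using a by auto
        then show ?thesis by (simp only: shell_factor_def sgn a(2))
      qed
      finally show ?thesis by (simp add: kernel_def True)
    qed (simp add: kernel_def)
  next
    have "(\<lambda>x. indicator (shell n) x *\<^sub>R (kernel x * shell_factor n)) =
        (\<lambda>x. (indicator (shell n) x *\<^sub>R kernel x) * shell_factor n)" by simp
    then show "shell_integral n (\<lambda>x. kernel x * shell_factor n)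
        (of_real (q powi (- n)) * kernel_value n * shell_factor n)"
      using kernel_shell_value[of n] unfolding shell_integral_def
      by (simp only:) (rule has_bochner_integral_mult_left)
  qed
  from shell_integral_mult_measure[OF this] show ?thesis
    by (simp add: power_int_minus)
qed

end

section \<open>Summation over the shells\<close>

lemma sum_telescope_two:
  fixes F :: "int \<Rightarrow> complex"
  assumes "C \<le> B"
  shows "(\<Sum>n\<in>{C + 1..B}. F n - F (n + 2)) = F (C + 1) + F (C + 2) - F (B + 1) - F (B + 2)"
  using assms
proof (induction B rule: int_ge_induct)
  case base
  show ?case by simp
next
  case (step B)
  then have "{C + 1..B + 1} = insert (B + 1) {C + 1..B}" by auto
  then show ?case using step by (simp add: add.assoc)
qed

context mock_setting
begin

text \<open>The shells that contribute are \<open>C, \<dots>, B + 1\<close>.\<close>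

abbreviation B :: int where "B \<equiv> ord s - h"
abbreviation C :: int where "C \<equiv> h - ord s - ord \<theta>"

definition gauss_sign :: "int \<Rightarrow> complex" where
  "gauss_sign n = (if even (B - n) then sgn_char \<pi> (- s) * G else 1)"

definition shell_weight :: "int \<Rightarrow> complex" where
  "shell_weight n = Q powi (- n) * gauss_sign n"

lemma C_le_B: "C \<le> B"
  using depth by simp

lemma gauss_sign_add_2: "gauss_sign (n + 2) = gauss_sign n"
  by (simp add: gauss_sign_def)

lemma Q_powi_Suc: "Q powi (- n) = Q * Q powi (- (n + 1))"
  using power_int_add_1'[of Q "- (n + 1)"] by simp

lemma shell_weight_add_2: "shell_weight n = of_real q * shell_weight (n + 2)"
proof -
  have "Q powi (- n) = Q * (Q * Q powi (- (n + 2)))"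
    using Q_powi_Suc[of n] Q_powi_Suc[of "n + 1"] by (simp add: add.assoc)
  also have "\<dots> = of_real q * Q powi (- (n + 2))"
    by (simp only: mult.assoc[symmetric] power2_eq_square[symmetric] Q_square)
  finally show ?thesis by (simp only: shell_weight_def gauss_sign_add_2 mult.assoc)
qed

lemma shell_factor_eq: "shell_factor n = Q powi (B - 1) * shell_weight n"
proof -
  have "Q powi (B - 1 + - n) = Q powi (B - 1) * Q powi (- n)" by (rule power_int_add) simp
  moreover have "B - 1 + - n = ord s - n - h - 1" by simp
  ultimately have "Q powi (ord s - n - h - 1) = Q powi (B - 1) * Q powi (- n)" by (simp only:)
  then show ?thesis by (simp only: shell_factor_def shell_weight_def gauss_sign_def mult.assoc)
qed

text \<open>With y, z, \<sigma> and \<tau> as in the proof, telescoping leaves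
  \<open>- (y + y * \<sigma> / Q) / 2\<close> at the upper end and shell \<open>B + 1\<close> adds
  \<open>(\<sigma> / Q - 1 / q) * y / 2\<close>: the Gauss sums cancel, so this end depends on no
  sign. At the lower end the \<open>- 1\<close> in the value of shell C is cancelled by half of
  \<open>shell_weight (C + 2)\<close>, and only the Gauss part of shell C and half of
  \<open>shell_weight (C + 1)\<close> survive.\<close>

lemma shell_sum:
  "(\<Sum>n\<in>{C..B + 1}. kernel_value n * shell_weight n) =
    (sgn_char \<pi> (s * \<theta>) * G * gauss_sign C + gauss_sign (C + 1)) / 2 * Q powi (- (C + 1)) -
    (1 + 1 / of_real q) / 2 * Q powi (- (B + 1))"
proof -
  define y where "y = Q powi (- (B + 1))"
  define z where "z = Q powi (- (C + 1))"
  let ?\<sigma> = "sgn_char \<pi> (- s) * G"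
  let ?\<tau> = "sgn_char \<pi> (s * \<theta>) * G"
  have qQ: "of_real q = Q * Q" by (simp only: power2_eq_square[symmetric] Q_square)
  have EB1: "shell_weight (B + 1) = y" by (simp add: shell_weight_def gauss_sign_def y_def)
  have EB2: "shell_weight (B + 2) = y * ?\<sigma> / Q"
    using Q_powi_Suc[of "B + 1"] by (simp add: shell_weight_def gauss_sign_def y_def add.assoc)
  have EC: "shell_weight C = Q * z * gauss_sign C"
    unfolding z_def shell_weight_def by (subst Q_powi_Suc) (rule refl)
  have EC1: "shell_weight (C + 1) = z * gauss_sign (C + 1)" by (simp add: shell_weight_def z_def)
  have EC2: "shell_weight (C + 2) = z * gauss_sign C / Q"
    using shell_weight_add_2[of C] unfolding EC qQ by (simp add: field_simps)
  have "{C..B + 1} = insert C (insert (B + 1) {C + 1..B})" using C_le_B by auto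
  then have "(\<Sum>n\<in>{C..B + 1}. kernel_value n * shell_weight n) =
      kernel_value C * shell_weight C + (kernel_value (B + 1) * shell_weight (B + 1) +
        (\<Sum>n\<in>{C + 1..B}. kernel_value n * shell_weight n))"
    using C_le_B by simp
  also have "kernel_value C = (Q * ?\<tau> - 1) / of_real (2 * q)"
    using C_le_B by (simp add: kernel_value_def)
  also have "kernel_value (B + 1) = (Q * ?\<sigma> - 1) / of_real (2 * q)"
    by (simp add: kernel_value_def)
  also have "(\<Sum>n\<in>{C + 1..B}. kernel_value n * shell_weight n) =
      (\<Sum>n\<in>{C + 1..B}. (shell_weight n - shell_weight (n + 2)) / 2)"
  proof (rule sum.cong[OF refl])
    fix n assume "n \<in> {C + 1..B}"
    then have "kernel_value n = of_real ((q - 1) / (2 * q))" by (simp add: kernel_value_def)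
    \<comment> \<open>For w the weight at \<open>n + 2\<close>, the weight at n is
      \<open>q * w\<close>. The interior value (q-1)/(2q) is just what makes the term half a
      difference of the two.\<close>
    moreover have "of_real ((q - 1) / (2 * q)) * (of_real q * w) = (of_real q * w - w) / 2" for w :: complex
      by (simp add: field_simps)
    ultimately show "kernel_value n * shell_weight n = (shell_weight n - shell_weight (n + 2)) / 2"
      by (simp only: shell_weight_add_2[of n])
  qed
  also have "\<dots> = (shell_weight (C + 1) + shell_weight (C + 2) - shell_weight (B + 1) - shell_weight (B + 2)) / 2"
    unfolding sum_telescope_two[OF C_le_B, symmetric] by (rule sum_divide_distrib[symmetric])
  finally have "(\<Sum>n\<in>{C..B + 1}. kernel_value n * shell_weight n) =
      (Q * ?\<tau> - 1) / (2 * (Q * Q)) * (Q * z * gauss_sign C) + ((Q * ?\<sigma> - 1) / (2 * (Q * Q)) * y +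
        (z * gauss_sign (C + 1) + z * gauss_sign C / Q - y - y * ?\<sigma> / Q) / 2)"
    by (simp only: EB1 EB2 EC EC1 EC2 of_real_mult of_real_numeral qQ)
  also have "\<dots> = (?\<tau> * gauss_sign C + gauss_sign (C + 1)) / 2 * z - (1 + 1 / (Q * Q)) / 2 * y"
    using Q_nonzero by (simp add: divide_simps del: of_real_eq_0_iff) (simp add: algebra_simps)
  finally show ?thesis by (simp only: y_def z_def qQ)
qed

section \<open>Square classes of \<theta> and the constant \<gamma>\<close>

lemma square_iff: "x \<noteq> 0 \<Longrightarrow> (\<exists>u. u \<noteq> 0 \<and> x = u\<^sup>2) \<longleftrightarrow> even (ord x) \<and> x \<in> norm_group \<pi>"
proof
  assume x: "x \<noteq> 0" and "even (ord x) \<and> x \<in> norm_group \<pi>"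
  then obtain m y where m: "ord x = 2 * m" and y: "x = (- \<pi>) powi (ord x) * y\<^sup>2"
    unfolding norm_group_iff by blast
  have "x = ((- \<pi>) powi m * y)\<^sup>2"
    using y unfolding m by (simp add: power_mult_distrib pi_power_int_square)
  moreover from this have "(- \<pi>) powi m * y \<noteq> 0" using x by auto
  ultimately show "\<exists>u. u \<noteq> 0 \<and> x = u\<^sup>2" by blast
qed (auto simp: square_in_norm_group ord_power)

text \<open>It is \<open>- \<pi>\<close> that is a norm, so this square class is detected on -x, not
  on x. With \<open>square_iff\<close> it expresses the cases of \<gamma> by the parity of the order
  and a value of sgn.\<close>

lemma pi_square_iff: "x \<noteq> 0 \<Longrightarrow> (\<exists>u. u \<noteq> 0 \<and> x = \<pi> * u\<^sup>2) \<longleftrightarrow> odd (ord x) \<and> - x \<in> norm_group \<pi>"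
proof
  assume x: "x \<noteq> 0" and "odd (ord x) \<and> - x \<in> norm_group \<pi>"
  then obtain m y where m: "ord x = 2 * m + 1" and y: "- x = (- \<pi>) powi (ord x) * y\<^sup>2"
    unfolding norm_group_iff by (metis oddE ord_minus)
  have "- x = - (\<pi> * ((- \<pi>) powi m * y)\<^sup>2)"
    using y unfolding m by (simp add: power_mult_distrib pi_power_int_square power_int_add mult_ac)
  then have "x = \<pi> * ((- \<pi>) powi m * y)\<^sup>2" by (simp only: neg_equal_iff_equal)
  moreover from this have "(- \<pi>) powi m * y \<noteq> 0" using x by auto
  ultimately show "\<exists>u. u \<noteq> 0 \<and> x = \<pi> * u\<^sup>2" by blast
next
  assume "\<exists>u. u \<noteq> 0 \<and> x = \<pi> * u\<^sup>2"
  then obtain u where u: "u \<noteq> 0" "x = \<pi> * u\<^sup>2" by blast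
  have "- x = (- \<pi>) powi 1 * u\<^sup>2" using u by simp
  also have "\<dots> \<in> norm_group \<pi>"
    by (intro norm_group_mult pi_power_in_norm_group square_in_norm_group u(1))
  finally show "odd (ord x) \<and> - x \<in> norm_group \<pi>" using u by (simp add: ord_mult ord_power)
qed

definition gamma :: complex where
  "gamma = (if \<exists>u. u \<noteq> 0 \<and> \<theta> = u\<^sup>2 then 1
    else if \<exists>u. u \<noteq> 0 \<and> \<theta> = \<pi> * u\<^sup>2 then sgn_char \<pi> (- s) * G else 0)"

text \<open>\<open>B - C\<close> has the parity of \<open>ord \<theta>\<close>. If that is even, the
  two Gauss sums meet in one product and G^2 = sgn(-1) gives sgn(\<theta>) + 1. If it is odd, each
  summand carries one G, and the sum is sgn(-s) G (sgn(-\<theta>) + 1). Either way the bracket is 2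
  or 0, which singles out the square classes in \<gamma>.\<close>

lemma gamma_eq: "sgn_char \<pi> (s * \<theta>) * G * gauss_sign C + gauss_sign (C + 1) = 2 * gamma"
proof -
  have BC: "B - C = 2 * (ord s - h) + ord \<theta>" by simp
  show ?thesis
  proof (cases "even (ord \<theta>)")
    case True
    then have w: "gauss_sign C = sgn_char \<pi> (- s) * G" "gauss_sign (C + 1) = 1"
      by (simp_all add: gauss_sign_def)
    have "sgn_char \<pi> (s * \<theta>) * sgn_char \<pi> (- s) * sgn_char \<pi> (- 1) = sgn_char \<pi> (s\<^sup>2 * \<theta>)"
      using s \<theta> by (simp add: power2_eq_square mult_ac flip: sgn_mult)
    also have "\<dots> = sgn_char \<pi> \<theta>" by (rule sgn_square_mult[OF s])
    finally have "sgn_char \<pi> (s * \<theta>) * G * (sgn_char \<pi> (- s) * G) = sgn_char \<pi> \<theta>"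
      by (simp only: G_square[symmetric] mult_ac)
    then show ?thesis
      unfolding w gamma_def square_iff[OF \<theta>] pi_square_iff[OF \<theta>]
      using True by (simp add: sgn_char_def)
  next
    case False
    then have w: "gauss_sign C = 1" "gauss_sign (C + 1) = sgn_char \<pi> (- s) * G"
      by (simp_all add: gauss_sign_def)
    have "sgn_char \<pi> (s * \<theta>) = sgn_char \<pi> (- s) * sgn_char \<pi> (- \<theta>)"
      using s \<theta> by (simp flip: sgn_mult)
    then show ?thesis
      unfolding w gamma_def square_iff[OF \<theta>] pi_square_iff[OF \<theta>]
      using False by (simp add: sgn_char_def)
  qed
qed

lemma Q_powi_eq: "Q powi m = of_real (q powr (real_of_int m / 2))"
proof -
  have "sqrt q powi m = (q powr (1 / 2)) powr real_of_int m"
    by (simp add: powr_real_of_int' powr_half_sqrt)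
  then have "sqrt q powi m = q powr (real_of_int m / 2)" by (simp add: powr_powr)
  then show ?thesis by (simp flip: of_real_power_int)
qed

lemma shell_total:
  "(\<Sum>\<^sub>\<infinity>n\<in>UNIV. kernel_value n * shell_factor n) =
    of_real (- (1 / 2) * q powi (- 2) * (q + 1)) +
    of_real (q powr (- (real_of_int h + 1)) * (q powi (- (2 * ord s + ord \<theta>))) powr (- 1 / 2)) * gamma"
proof -
  have "((\<lambda>n. kernel_value n * shell_factor n) has_sum (\<Sum>n\<in>{C..B + 1}. kernel_value n * shell_factor n)) UNIV"
    by (rule has_sum_finite_neutralI[where B = "{C..B + 1}"]) (use depth in \<open>auto simp: kernel_value_def\<close>)
  then have "(\<Sum>\<^sub>\<infinity>n\<in>UNIV. kernel_value n * shell_factor n) = (\<Sum>n\<in>{C..B + 1}. kernel_value n * shell_factor n)"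
    by (rule infsumI)
  also have "\<dots> = Q powi (B - 1) * (\<Sum>n\<in>{C..B + 1}. kernel_value n * shell_weight n)"
    unfolding shell_factor_eq sum_distrib_left by (simp only: mult_ac)
  also have "\<dots> = Q powi (B - 1) * (gamma * Q powi (- (C + 1)) -
      (1 + 1 / of_real q) / 2 * Q powi (- (B + 1)))"
    unfolding shell_sum gamma_eq by simp
  also have "\<dots> = Q powi (B - 1) * Q powi (- (C + 1)) * gamma -
      (1 + 1 / of_real q) / 2 * (Q powi (B - 1) * Q powi (- (B + 1)))"
    by (simp only: right_diff_distrib mult_ac)
  also have "Q powi (B - 1) * Q powi (- (B + 1)) = of_real (q powi (- 1))"
  proof -
    have "Q powi (B - 1 + - (B + 1)) = Q powi (B - 1) * Q powi (- (B + 1))"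
      by (rule power_int_add) simp
    moreover have "B - 1 + - (B + 1) = 2 * (- 1)" by simp
    ultimately show ?thesis by (simp only: Q_powi_even)
  qed
  \<comment> \<open>The exponent is \<open>2 * ord s + ord \<theta> - 2 * (h + 1)\<close>, so this
    power of Q is q^(-(h+1)) times the absolute value of \<open>s\<^sup>2 * \<theta>\<close> to the
    power -1/2.\<close>
  also have "Q powi (B - 1) * Q powi (- (C + 1)) =
      of_real (q powr (- (real_of_int h + 1)) * (q powi (- (2 * ord s + ord \<theta>))) powr (- 1 / 2))"
  proof -
    have "Q powi (B - 1 + - (C + 1)) = Q powi (B - 1) * Q powi (- (C + 1))"
      by (rule power_int_add) simp
    moreover have "q powr (- (real_of_int h + 1)) * (q powi (- (2 * ord s + ord \<theta>))) powr (- 1 / 2) =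
        q powr (real_of_int (B - 1 + - (C + 1)) / 2)"
    proof -
      have "q powi (- (2 * ord s + ord \<theta>)) = q powr real_of_int (- (2 * ord s + ord \<theta>))"
        by (rule powr_real_of_int'[symmetric]) simp_all
      then have "q powr (- (real_of_int h + 1)) * (q powi (- (2 * ord s + ord \<theta>))) powr (- 1 / 2) =
          q powr (- (real_of_int h + 1) + real_of_int (- (2 * ord s + ord \<theta>)) * (- 1 / 2))"
        by (simp only: powr_powr powr_add)
      then show ?thesis by (simp add: field_simps)
    qed
    ultimately show ?thesis by (simp only: Q_powi_eq)
  qed
  \<comment> \<open>The origin of c_0: (1 + 1/q)/2 times 1/q is (q + 1)/(2 q^2).\<close>
  also have "(1 + 1 / of_real q) / 2 * of_real (q powi (- 1)) =
      (- of_real (- (1 / 2) * q powi (- 2) * (q + 1)) :: complex)"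
    by (simp add: power_int_minus field_simps power2_eq_square)
  finally show ?thesis by simp
qed

end


section \<open>Characters and depth\<close>

text \<open>The image of \<open>\<pp>\<^sup>m\<close> is a group inside the disc of radius \<open>1/2\<close> around \<open>1\<close>, and there doubling the
  argument expands the distance to \<open>1\<close> by at least \<open>3/2\<close>.\<close>

lemma additive_character_trivial_on_pideal:
  fixes \<Psi> :: "'k::nonarch_local_field \<Rightarrow> complex"
  assumes "additive_character \<Psi>"
  shows "\<exists>m. \<forall>x\<in>pideal m. \<Psi> x = 1"
proof -
  let ?q = "real (residue_order TYPE('k))"
  have hom: "\<Psi> (x + y) = \<Psi> x * \<Psi> y" and norm: "norm (\<Psi> x) = 1" for x y
    using assms by (simp_all add: additive_character_def)
  have "\<Psi> 0 \<noteq> 0" using norm[of 0] by auto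
  then have zero: "\<Psi> 0 = 1" using hom[of 0 0] by simp
  have "continuous_on UNIV \<Psi>" using assms by (simp add: additive_character_def)
  then obtain e where e: "e > 0" "\<And>x. dist x 0 < e \<Longrightarrow> dist (\<Psi> x) (\<Psi> 0) < 1 / 2"
    unfolding continuous_on_iff by (metis UNIV_I zero_less_divide_1_iff zero_less_numeral)
  obtain n where n: "inverse e < ?q ^ n" using real_arch_pow[OF residue_order_real_gt_1] by blast
  then have "?q powi (- int n) < e"
    using e residue_order_real_gt_1[where 'k = 'k] by (simp add: power_int_minus field_simps)
  then have small: "norm (\<Psi> x - 1) \<le> 1 / 2" if "x \<in> pideal (int n)" for x
    using e(2)[of x] dist_le_iff[of x 0 "int n"] that zero by (simp add: dist_norm)
  have bound: "norm (\<Psi> x - 1) \<le> (2 / 3) ^ k * (1 / 2)" if "x \<in> pideal (int n)" for x k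
    using that
  proof (induction k arbitrary: x)
    case 0
    then show ?case using small by simp
  next
    case (Suc k)
    have "norm (\<Psi> x + 1) \<ge> 3 / 2"
      using norm_triangle_ineq2[of 2 "1 - \<Psi> x"] small[OF Suc.prems]
      by (simp add: norm_minus_commute add.commute)
    then have "3 / 2 * norm (\<Psi> x - 1) \<le> norm (\<Psi> x + 1) * norm (\<Psi> x - 1)"
      by (rule mult_right_mono) simp
    also have "\<dots> = norm (\<Psi> (x + x) - 1)"
    proof -
      have "\<Psi> (x + x) - 1 = (\<Psi> x + 1) * (\<Psi> x - 1)"
        unfolding hom by (simp add: algebra_simps)
      then show ?thesis by (simp only: norm_mult)
    qed
    also have "\<dots> \<le> (2 / 3) ^ k * (1 / 2)" by (rule Suc.IH[OF pideal_add[OF Suc.prems Suc.prems]])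
    finally show ?case by simp
  qed
  have lim: "(\<lambda>k. (2 / 3) ^ k * (1 / 2) :: real) \<longlonglongrightarrow> 0"
    by (intro tendsto_mult_left_zero LIMSEQ_power_zero) simp
  have "norm (\<Psi> x - 1) \<le> 0" if "x \<in> pideal (int n)" for x
    by (rule LIMSEQ_le_const[OF lim]) (use bound[OF that] in blast)
  then show ?thesis by auto
qed

text \<open>Counting downwards from a level m of triviality by a natural number k makes the least
  counterexample available. It is not \<open>k = 0\<close>, so the level just above it is
  trivial.\<close>

lemma additive_character_conductor:
  fixes \<Psi> :: "'k::nonarch_local_field \<Rightarrow> complex"
  assumes char: "additive_character \<Psi>" and nontriv: "\<Psi> x0 \<noteq> 1"
  obtains h where "\<forall>x\<in>pideal (h + 1). \<Psi> x = 1" "\<exists>x\<in>pideal h. \<Psi> x \<noteq> 1"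
proof -
  obtain m where m: "\<And>x. x \<in> pideal m \<Longrightarrow> \<Psi> x = 1"
    using additive_character_trivial_on_pideal[OF char] by blast
  have "x0 \<noteq> 0" using nontriv m[of 0] by auto
  then have "x0 \<in> pideal (m - int (nat (m - ord x0)))" by (simp add: pideal_iff_ord)
  then have ex: "\<exists>k. \<exists>x\<in>pideal (m - int k). \<Psi> x \<noteq> 1" using nontriv by blast
  define k where "k = (LEAST k. \<exists>x\<in>pideal (m - int k). \<Psi> x \<noteq> 1)"
  have k: "\<exists>x\<in>pideal (m - int k). \<Psi> x \<noteq> 1" unfolding k_def using ex by (rule LeastI_ex)
  then have "k \<noteq> 0" using m by (cases "k = 0") auto
  then have "\<not> (\<exists>x\<in>pideal (m - int (k - 1)). \<Psi> x \<noteq> 1)"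
    unfolding k_def by (intro not_less_Least) simp
  moreover have "m - int (k - 1) = m - int k + 1" using \<open>k \<noteq> 0\<close> by simp
  ultimately have "\<not> (\<exists>x\<in>pideal (m - int k + 1). \<Psi> x \<noteq> 1)" by (simp only:) simp
  then show ?thesis using k by (intro that[of "m - int k"]) blast+
qed

lemma dual_elt_torus: "dual_elt \<beta> \<theta> (smat c (sqrt_mat \<theta>)) = \<beta> * (2 * \<theta> * c)"
  by (simp add: dual_elt_def smat_def sqrt_mat_def trace_def matrix_matrix_mult_def sum_2 mult_ac)

lemma torus_depth_smat: "torus_depth \<theta> (smat c (sqrt_mat \<theta>)) = real_of_int (ord (c\<^sup>2 * \<theta>)) / 2"
  by (simp add: torus_depth_def smat_def sqrt_mat_def)

lemma disc_g_smat: "disc_g (smat c (sqrt_mat \<theta>)) = 4 * (c\<^sup>2 * \<theta>)"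
  by (simp add: disc_g_def smat_def sqrt_mat_def power2_eq_square mult_ac)

context character_setting
begin

text \<open>At Z = \<open>c * sqrt \<pi>\<close> the functional gives
  \<open>\<Psi> (2 * \<pi> * c)\<close>, whose argument has order \<open>ord c + 1\<close>, while Z
  has depth \<open>ord c + 1 / 2\<close>; this offset is the source of the 1/2. The strict
  inequality in \<open>dual_depth\<close> makes the maximum attained, and
  \<open>c = w / (2 * \<pi>)\<close> with \<open>\<Psi> w \<noteq> 1\<close> shows that no larger
  real \<rho> works.\<close>

lemma dual_depth_eq:
  assumes "\<Psi> = char_scale \<Phi> \<beta>"
  shows "dual_depth \<Phi> \<pi> (dual_elt \<beta> \<pi>) = 1 / 2 - real_of_int h"
proof -
  have eq: "\<Phi> (dual_elt \<beta> \<pi> (smat c (sqrt_mat \<pi>))) = \<Psi> (2 * \<pi> * c)" for c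
    by (simp add: dual_elt_torus assms char_scale_def)
  have ord_c: "ord (2 * \<pi> * c) = ord c + 1" "torus_depth \<pi> (smat c (sqrt_mat \<pi>)) = real_of_int (ord c) + 1 / 2"
    if "c \<noteq> 0" for c
    using that ord_two[OF two] by (simp_all add: torus_depth_smat ord_mult ord_power field_simps)
  show ?thesis
    unfolding dual_depth_def
  proof (rule Greatest_equality)
    show "\<forall>Z\<in>torus \<pi>. - (1 / 2 - real_of_int h) < torus_depth \<pi> Z \<longrightarrow> \<Phi> (dual_elt \<beta> \<pi> Z) = 1"
    proof (intro ballI impI)
      fix Z assume "Z \<in> torus \<pi>" and Z: "- (1 / 2 - real_of_int h) < torus_depth \<pi> Z"
      then obtain c where c: "Z = smat c (sqrt_mat \<pi>)" by (auto simp: torus_def)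
      show "\<Phi> (dual_elt \<beta> \<pi> Z) = 1"
      proof (cases "c = 0")
        case False
        then have "h + 1 \<le> ord (2 * \<pi> * c)" using Z ord_c[OF False] by (simp add: c)
        then have "2 * \<pi> * c \<in> pideal (h + 1)" by (simp add: pideal_def)
        then show ?thesis by (simp only: c eq trivial)
      qed (simp add: c eq)
    qed
  next
    fix \<rho> assume \<rho>: "\<forall>Z\<in>torus \<pi>. - \<rho> < torus_depth \<pi> Z \<longrightarrow> \<Phi> (dual_elt \<beta> \<pi> Z) = 1"
    obtain w where w: "w \<in> pideal h" "\<Psi> w \<noteq> 1" using nontrivial by blast
    define c where "c = w / (2 * \<pi>)"
    have w_eq: "2 * \<pi> * c = w" using ord_two[OF two] by (simp add: c_def)
    have "w \<noteq> 0" using w by auto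
    then have c: "c \<noteq> 0" using w_eq by auto
    have "smat c (sqrt_mat \<pi>) \<in> torus \<pi>" by (simp add: torus_def)
    then have "\<not> - \<rho> < torus_depth \<pi> (smat c (sqrt_mat \<pi>))"
      using \<rho> w eq[of c] by (auto simp: w_eq)
    moreover have "h \<le> ord c + 1" using w \<open>w \<noteq> 0\<close> ord_c(1)[OF c] by (simp add: w_eq pideal_iff_ord)
    ultimately show "\<rho> \<le> 1 / 2 - real_of_int h" using ord_c(2)[OF c] by linarith
  qed
qed

end

theorem theorem10p6:
  fixes \<pi> \<beta> s \<theta>' :: "'k::nonarch_local_field"
    and \<Phi> :: "'k \<Rightarrow> complex"
    and \<mu> :: "'k measure"
    and X :: "'k^2^2 \<Rightarrow> 'k"
    and Y :: "'k^2^2"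
    and q r h :: real
  assumes odd_residual_char: "(2::'k) \<notin> pideal 1"
    and unif: "uniformiser \<pi>"
    and haar: "normalised_haar \<mu>"
    and char: "additive_character \<Phi>" "\<exists>x. \<Phi> x \<noteq> 1"
    and nonzero: "\<beta> \<noteq> 0" "s \<noteq> 0" "\<theta>' \<noteq> 0"
    and X: "X = dual_elt \<beta> \<pi>"
    and Y: "Y = smat s (sqrt_mat \<theta>')"
    and q: "q = real (residue_order TYPE('k))"
    and r: "r = - dual_depth \<Phi> \<pi> X"
    and h: "h = r + 1 / 2"
    and depth: "dual_depth \<Phi> \<pi> X + torus_depth \<theta>' Y > 0"
  shows "mock_fourier \<mu> \<Phi> \<pi> \<beta> s \<theta>' =
           of_real (c0_ramified TYPE('k)) +
           of_real (q powr (- (h + 1)) * absv (disc_g Y) powr (- 1 / 2)) *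
             gamma_const \<Phi> \<pi> \<beta> s \<theta>'"
proof -
  define \<Psi> where "\<Psi> = char_scale \<Phi> \<beta>"
  have "continuous_on UNIV (\<lambda>x. \<Phi> (\<beta> * x))"
    using char(1) unfolding additive_character_def
    by (intro continuous_on_compose2[OF _ continuous_mult_left]) auto
  then have \<Psi>: "additive_character \<Psi>"
    using char(1) by (simp add: additive_character_def \<Psi>_def char_scale_def ring_distribs)
  obtain x0 where "\<Phi> x0 \<noteq> 1" using char(2) by blast
  then have "\<Psi> (x0 / \<beta>) \<noteq> 1" using nonzero by (simp add: \<Psi>_def char_scale_def)
  then obtain d where triv: "\<forall>x\<in>pideal (d + 1). \<Psi> x = 1" and nontriv: "\<exists>x\<in>pideal d. \<Psi> x \<noteq> 1"
    by (rule additive_character_conductor[OF \<Psi>])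
  have hom: "\<Psi> (x + y) = \<Psi> x * \<Psi> y" for x y using \<Psi> by (simp add: additive_character_def)
  interpret character_setting \<pi> \<Psi> d q
    by unfold_locales (use odd_residual_char unif q hom triv nontriv in blast)+
  have dd: "dual_depth \<Phi> \<pi> X = 1 / 2 - real_of_int d"
    unfolding X by (rule dual_depth_eq) (rule \<Psi>_def)
  have "torus_depth \<theta>' Y = real_of_int (2 * ord s + ord \<theta>') / 2"
    using nonzero by (simp add: Y torus_depth_smat ord_mult ord_power)
  \<comment> \<open>Doubling clears both halves; over the integers the strict inequality with the
    extra 1 becomes a weak one without it.\<close>
  then have "real_of_int (2 * d) < real_of_int (2 * ord s + ord \<theta>' + 1)"
    using depth dd by simp
  then have depth_int: "2 * d \<le> 2 * ord s + ord \<theta>'" by (simp only: of_int_less_iff)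
  interpret mock_setting \<pi> \<Psi> d q \<mu> s \<theta>'
    by unfold_locales (fact haar nonzero depth_int)+
  have h_eq: "h = real_of_int d" using h r dd by simp
  have "(4 :: 'k) = 2 * 2" by simp
  then have four: "(4 :: 'k) \<noteq> 0" "ord (4 :: 'k) = 0"
    using ord_two[OF odd_residual_char] ord_mult[of "2 :: 'k" 2] by (metis mult_eq_0_iff, simp)
  have absv_eq: "absv (disc_g Y) = q powi (- (2 * ord s + ord \<theta>'))"
    using nonzero four
    by (simp add: Y disc_g_smat absv_def ord_mult ord_power q)
  have gamma_eq: "gamma_const \<Phi> \<pi> \<beta> s \<theta>' = gamma"
    unfolding gamma_const_def gamma_def by (simp only: \<Psi>_def)
  have "mock_fourier \<mu> \<Phi> \<pi> \<beta> s \<theta>' = (\<Sum>\<^sub>\<infinity>n\<in>UNIV. kernel_value n * shell_factor n)"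
    unfolding mock_fourier_def mock_shell_value[symmetric]
    by (simp only: \<Psi>_def char_scale_def mult.assoc)
  then show ?thesis
    by (simp only: shell_total h_eq absv_eq gamma_eq c0_ramified_def q[symmetric])
qed

end
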